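(* Let $U$ be a double-well potential on $\mathbb R$ with local minima $x_0<x_2$ and local maximum $x_1\in(x_0,x_2)$. For $\varepsilon>0$ let $(X^\varepsilon_t,Y^\varepsilon_t)_{t\ge 0}$ be the velocity jump process on $\mathbb R\times\{\pm1\}$ with potential $U$ at temperature $\varepsilon$, started at $(X_0^\varepsilon,Y_0^\varepsilon)=(x_0,-1)$, and let $\tau=\inf\{t>0:\ X_t^\varepsilon=x_1\}$. Then, as $\varepsilon\to0$, $$\mathbb E[\tau]=\sqrt{\frac{8\pi\varepsilon}{U''(x_0)}}\;e^{\frac{U(x_1)-U(x_0)}{\varepsilon}}\,(1+o(1)),$$ and, for every $t\ge 0$, $$\mathbb P\big(\tau\ge t\,\mathbb E[\tau]\big)\xrightarrow[\varepsilon\to0]{}e^{-t}.$$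
   Context: Double-well potential: $U:\mathbb R\to\mathbb R$ is a (smooth) Morse function, i.e. $U'(x)=0\Rightarrow U''(x)\neq0$, with exactly two local minima $x_0<x_2$ and one local maximum $x_1\in(x_0,x_2)$, convex outside $(x_0,x_2)$, and $U(x)\to+\infty$ as $|x|\to\infty$. Velocity jump process at fixed temperature $\varepsilon>0$: the piecewise deterministic Markov process on $\mathbb R\times\{\pm1\}$ with generator $$Lf(x,y)=y\,\partial_xf(x,y)+\tfrac1\varepsilon\,(yU'(x))_+\,\big(f(x,-y)-f(x,y)\big),$$ where $(g)_+=\max(g,0)$. Concretely, with $(E_i)_{i\ge0}$ i.i.d. exponential variables of mean 1 and $T_0=0$: $T_{i+1}=\inf\{t>T_i:\ \int_{T_i}^t\frac1\varepsilon(Y_{T_i}U'(X_{T_i}+Y_{T_i}(s-T_i)))_+ds\ge E_i\}$; on $[T_i,T_{i+1}]$, $X_s=X_{T_i}+Y_{T_i}(s-T_i)$; on $[T_i,T_{i+1})$, $Y_s=Y_{T_i}$; and $Y_{T_{i+1}}=-Y_{T_i}$. *)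

theory Defs
  imports "HOL-Probability.Probability" "HOL-Library.Landau_Symbols"
begin

definition smooth :: "(real \<Rightarrow> real) \<Rightarrow> bool" where
  "smooth U \<longleftrightarrow> (\<forall>n x. ((deriv ^^ n) U) differentiable (at x))"

definition morse :: "(real \<Rightarrow> real) \<Rightarrow> bool" where
  "morse U \<longleftrightarrow> (\<forall>x. deriv U x = 0 \<longrightarrow> deriv (deriv U) x \<noteq> 0)"

definition is_local_min :: "(real \<Rightarrow> real) \<Rightarrow> real \<Rightarrow> bool" where
  "is_local_min U x \<longleftrightarrow> (\<forall>\<^sub>F y in nhds x. U x \<le> U y)"

definition is_local_max :: "(real \<Rightarrow> real) \<Rightarrow> real \<Rightarrow> bool" where
  "is_local_max U x \<longleftrightarrow> (\<forall>\<^sub>F y in nhds x. U y \<le> U x)"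

definition double_well :: "(real \<Rightarrow> real) \<Rightarrow> real \<Rightarrow> real \<Rightarrow> real \<Rightarrow> bool" where
  "double_well U x0 x1 x2 \<longleftrightarrow>
     smooth U \<and> morse U \<and>
     x0 < x1 \<and> x1 < x2 \<and>
     {x. is_local_min U x} = {x0, x2} \<and>
     {x. is_local_max U x} = {x1} \<and>
     convex_on {..x0} U \<and> convex_on {x2..} U \<and>
     filterlim U at_top at_top \<and> filterlim U at_top at_bot"

definition iid_exponential :: "'a measure \<Rightarrow> (nat \<Rightarrow> 'a \<Rightarrow> real) \<Rightarrow> bool" where
  "iid_exponential M E \<longleftrightarrow>
     prob_space M \<and>
     prob_space.indep_vars M (\<lambda>_. borel) E UNIV \<and>
     (\<forall>i. distributed M lborel (E i) (exponential_density 1))"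

text \<open>
  The jump skeleton \<open>(T\<^sub>i, X at T\<^sub>i, Y at T\<^sub>i)\<close> of the velocity jump process started at
  \<open>(x, y)\<close>, as a function of the realised clocks \<open>e\<close>; velocities are the reals \<open>1\<close> and \<open>-1\<close>.
  The infimum is taken in the reals. If \<open>U\<close> is continuously differentiable and tends to
  infinity at both ends, the set is nonempty, so no convention for the infimum of the empty
  set is needed.
\<close>

primrec vjp_skeleton ::
  "(real \<Rightarrow> real) \<Rightarrow> real \<Rightarrow> real \<Rightarrow> real \<Rightarrow> (nat \<Rightarrow> real) \<Rightarrow> nat \<Rightarrow> real \<times> real \<times> real" where
  "vjp_skeleton U \<epsilon> x y e 0 = (0, x, y)"
| "vjp_skeleton U \<epsilon> x y e (Suc i) =
    (let (T, X, Y) = vjp_skeleton U \<epsilon> x y e i;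
         T' = Inf {t. T < t \<and>
                 integral {T..t} (\<lambda>s. 1 / \<epsilon> * max (Y * deriv U (X + Y * (s - T))) 0) \<ge> e i}
     in (T', X + Y * (T' - T), - Y))"

definition vjp_time ::
  "(real \<Rightarrow> real) \<Rightarrow> real \<Rightarrow> real \<Rightarrow> real \<Rightarrow> (nat \<Rightarrow> real) \<Rightarrow> nat \<Rightarrow> real" where
  "vjp_time U \<epsilon> x y e i = fst (vjp_skeleton U \<epsilon> x y e i)"

text \<open>
  The pair (position, velocity) at time \<open>t \<ge> 0\<close>. The index \<open>i\<close> exists unless \<open>t\<close> lies beyond
  an accumulation point of jump times, where the value is irrelevant junk.
\<close>

definition vjp ::
  "(real \<Rightarrow> real) \<Rightarrow> real \<Rightarrow> real \<Rightarrow> real \<Rightarrow> (nat \<Rightarrow> real) \<Rightarrow> real \<Rightarrow> real \<times> real" where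
  "vjp U \<epsilon> x y e t =
    (let i = (THE i. vjp_time U \<epsilon> x y e i \<le> t \<and> t < vjp_time U \<epsilon> x y e (Suc i));
         (T, X, Y) = vjp_skeleton U \<epsilon> x y e i
     in (X + Y * (t - T), Y))"

text \<open>Valued in \<open>ennreal\<close>, so that the hitting time is \<open>\<infinity>\<close> when \<open>a\<close> is never hit.\<close>

definition hitting_time :: "(real \<Rightarrow> real) \<Rightarrow> real \<Rightarrow> ennreal" where
  "hitting_time X a = Inf {ennreal t | t. 0 < t \<and> X t = a}"

end

theory Submission
  imports Defs
begin

text \<open>
  Downhill the process never turns; uphill it turns as soon as the height gained equals
  \<open>\<epsilon>\<close> times the next clock. So, as long as it stays left of \<open>x1\<close>, it leaves the bottom
  \<open>x0\<close>, climbs, turns, and comes back to \<open>x0\<close> at full speed, alternately on the left and on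
  the right side of the well. Each side is climbed from the bottom with a fresh clock, so the
  motion is a sequence of independent identically distributed cycles: clock \<open>2m\<close> fixes the length
  \<open>l\<close> of the \<open>m\<close>-th left excursion and clock \<open>2m+1\<close> the length \<open>r\<close> of the \<open>m\<close>-th right
  excursion, and every excursion is travelled twice. The process escapes in the first cycle whose
  odd clock exceeds \<open>D = (U x1 - U x0) / \<epsilon>\<close>, which happens with probability \<open>p = exp (- D)\<close> in
  every cycle. This turns \<open>\<tau>\<close> into a geometric sum (\<open>hitting_time_well\<close>,
  \<open>escape_cycles_well\<close>), with \<open>H = x1 - x0\<close> for the final climb.
  
  For a geometric sum both quantities of interest are available exactly, from the independence of
  the clocks and a geometric series. The mean is \<open>H + 2 (E l + E r) / p\<close>
  (\<open>expectation_\<tau>\<close>), and the characteristic function at \<open>\<theta>\<close> is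
  \<open>\<alpha> p e\<^sup>i\<^sup>\<theta>\<^sup>H / (1 - \<alpha> \<beta>)\<close>, where \<open>\<alpha>\<close> and \<open>\<beta>\<close> are the
  characteristic functions of one left excursion and of one right excursion that fails to escape
  (\<open>expectation_iexp_\<tau>\<close>).
  
  Small \<open>\<epsilon>\<close> enters only through the shape of \<open>U\<close> near \<open>x0\<close>. A climb of height \<open>u\<close> out of a
  quadratic well has length about \<open>sqrt (2 u / U'' x0)\<close> (\<open>reach_asymptotics\<close>,
  \<open>climb_quadratic\<close>), so \<open>l\<close> and \<open>r\<close> divided by \<open>sqrt \<epsilon>\<close> converge to
  \<open>sqrt (2 / U'' x0) * sqrt v\<close> at clock value \<open>v\<close>; they are dominated, on the left because a convex
  \<open>U\<close> grows at least linearly and on the right because an excursion is shorter than \<open>H\<close>. The mean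
  of the square root of a standard exponential variable is \<open>sqrt pi / 2\<close>, and since
  \<open>H\<close> is negligible against \<open>sqrt \<epsilon> / p\<close> the mean is equivalent to
  \<open>2 * 2 * sqrt (2 \<epsilon> / U'' x0) * (sqrt pi / 2) / p\<close>, which is the Eyring-Kramers formula.
  
  With \<open>\<theta> = s / E \<tau>\<close>, which is of order \<open>p / sqrt \<epsilon>\<close>, dominated convergence also gives
  \<open>\<alpha> = 1 + i s p / 2 + o(p)\<close> and \<open>\<beta> = 1 - p + i s p / 2 + o(p)\<close>. Hence the characteristic
  function of \<open>\<tau> / E \<tau>\<close> tends to \<open>1 / (1 - i s)\<close>, that of an exponential variable, and the
  continuity theorem of Levy concludes.
\<close>

section \<open>Climbing a coercive potential\<close>

text \<open>
  The uphill work of the path of length \<open>h\<close> that leaves \<open>x\<close> in direction \<open>y\<close>: only the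
  parts where \<open>U\<close> increases along the path count. Apart from the factor \<open>1 / \<epsilon>\<close> this is the
  integrated jump rate.
\<close>

definition climb :: "(real \<Rightarrow> real) \<Rightarrow> real \<Rightarrow> real \<Rightarrow> real \<Rightarrow> real" where
  "climb U x y h = integral {0..h} (\<lambda>s. max (y * deriv U (x + y * s)) 0)"

text \<open>
  The distance travelled before the uphill work amounts to \<open>u\<close>. For \<open>u \<le> 0\<close> the infimum is \<open>0\<close>, so that
  a clock with a nonpositive value rings at once.
\<close>

definition reach :: "(real \<Rightarrow> real) \<Rightarrow> real \<Rightarrow> real \<Rightarrow> real \<Rightarrow> real" where
  "reach U x y u = Inf {h. 0 < h \<and> u \<le> climb U x y h}"

locale coercive_potential =
  fixes U :: "real \<Rightarrow> real"
  assumes has_deriv: "(U has_real_derivative deriv U x) (at x)"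
    and deriv_cont: "continuous_on UNIV (deriv U)"
    and coercive: "filterlim U at_top at_top" "filterlim U at_top at_bot"
begin

lemma rate_cont: "continuous_on S (\<lambda>s. max (y * deriv U (x + y * s)) 0)"
  by (intro continuous_intros continuous_on_compose2[OF deriv_cont]) auto

lemma rate_integrable: "(\<lambda>s. max (y * deriv U (x + y * s)) 0) integrable_on {a..b}"
  by (intro integrable_continuous_real rate_cont)

lemma climb_nonpos [simp]: "h \<le> 0 \<Longrightarrow> climb U x y h = 0"
  unfolding climb_def by (cases "h = 0") auto

lemma climb_split:
  assumes "0 \<le> g" "g \<le> h"
  shows "climb U x y h = climb U x y g + climb U (x + y * g) y (h - g)"
proof -
  let ?f = "\<lambda>s. max (y * deriv U (x + y * s)) 0"
  have "climb U x y h = integral {0..g} ?f + integral {g..h} ?f"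
    unfolding climb_def using assms
    by (intro Henstock_Kurzweil_Integration.integral_combine[symmetric] rate_integrable) auto
  also have "integral {g..h} ?f = integral {0..h - g} (?f \<circ> (\<lambda>s. s + g))"
    using integral_shift[where a = 0 and b = "h - g" and c = g and f = ?f] rate_cont by simp
  also have "\<dots> = climb U (x + y * g) y (h - g)"
    unfolding climb_def by (simp add: o_def algebra_simps)
  finally show ?thesis by (simp add: climb_def)
qed

lemma climb_nonneg: "0 \<le> climb U x y h"
  unfolding climb_def by (intro integral_nonneg rate_integrable) auto

lemma climb_mono: "g \<le> h \<Longrightarrow> climb U x y g \<le> climb U x y h"
  using climb_split[of g h x y] climb_nonneg[of "x + y * g" y "h - g"] climb_nonneg[of x y h]
  by (cases "0 \<le> g") auto

lemma climb_cont: "continuous_on {0..b} (climb U x y)"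
  unfolding climb_def[abs_def] by (intro indefinite_integral_continuous_1 rate_integrable)

lemma climb_cont_start: "continuous_on S (\<lambda>x. climb U x y h)"
proof -
  have "continuous_on UNIV (\<lambda>x. integral (cbox 0 h) (\<lambda>s. max (y * deriv U (x + y * s)) 0))"
    by (rule integral_continuous_on_param)
      (auto simp: case_prod_beta intro!: continuous_intros continuous_on_compose2[OF deriv_cont])
  then show ?thesis
    unfolding climb_def by (auto intro: continuous_on_subset)
qed

lemma has_deriv_along: "((\<lambda>s. U (x + y * s)) has_real_derivative y * deriv U (x + y * s)) (at s within S)"
proof -
  have "((\<lambda>s. x + y * s) has_real_derivative y) (at s within S)"
    by (auto intro!: derivative_eq_intros)
  from DERIV_chain2[OF has_deriv this] show ?thesis by (simp add: mult.commute)
qed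

lemma work_integral:
  assumes "0 \<le> h"
  shows "((\<lambda>s. y * deriv U (x + y * s)) has_integral U (x + y * h) - U x) {0..h}"
  using fundamental_theorem_of_calculus[OF assms, of "\<lambda>s. U (x + y * s)" "\<lambda>s. y * deriv U (x + y * s)"]
    has_deriv_along by (simp add: has_real_derivative_iff_has_vector_derivative)

lemma climb_ge:
  assumes "0 \<le> h"
  shows "U (x + y * h) - U x \<le> climb U x y h"
  unfolding climb_def
  by (rule has_integral_le[OF work_integral[OF assms] integrable_integral[OF rate_integrable]]) auto

lemma climb_eq_rise:
  assumes "0 \<le> h" "\<And>s. 0 \<le> s \<Longrightarrow> s \<le> h \<Longrightarrow> 0 \<le> y * deriv U (x + y * s)"
  shows "climb U x y h = U (x + y * h) - U x"
  unfolding climb_def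
  by (rule integral_unique, rule has_integral_eq[OF _ work_integral[OF assms(1)]]) (use assms in auto)

lemma climb_eq_0:
  assumes "\<And>s. 0 \<le> s \<Longrightarrow> s \<le> h \<Longrightarrow> y * deriv U (x + y * s) \<le> 0"
  shows "climb U x y h = 0"
proof -
  have "climb U x y h = integral {0..h} (\<lambda>_. 0)"
    unfolding climb_def by (rule Henstock_Kurzweil_Integration.integral_cong) (use assms in auto)
  then show ?thesis by simp
qed

text \<open>
  This is where coercivity matters: it makes the sets nonempty whose infimum defines the jump times.
\<close>

lemma climb_unbounded:
  assumes "y = 1 \<or> y = -1"
  shows "\<exists>h>0. u \<le> climb U x y h"
proof -
  have "filterlim (\<lambda>h. U (x + y * h)) at_top at_top"
    using assms
  proof
    assume [simp]: "y = 1"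
    have "filterlim (\<lambda>h. x + y * h) at_top at_top"
      by (simp add: filterlim_tendsto_add_at_top[OF tendsto_const] filterlim_ident)
    from filterlim_compose[OF coercive(1) this] show ?thesis .
  next
    assume [simp]: "y = -1"
    have "filterlim (\<lambda>h. - (- x + h)) at_bot at_top"
      by (intro filterlim_compose[OF filterlim_uminus_at_bot_at_top]
          filterlim_tendsto_add_at_top[OF tendsto_const] filterlim_ident)
    then have "filterlim (\<lambda>h. x + y * h) at_bot at_top" by simp
    from filterlim_compose[OF coercive(2) this] show ?thesis .
  qed
  then have "eventually (\<lambda>h. u + U x \<le> U (x + y * h)) at_top"
    by (simp add: filterlim_at_top)
  with eventually_gt_at_top[of 0] have "eventually (\<lambda>h. 0 < h \<and> u \<le> climb U x y h) at_top"
    by eventually_elim (use climb_ge in \<open>smt (verit)\<close>)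
  from eventually_happens'[OF _ this] show ?thesis by simp
qed

lemma reach_less_iff:
  assumes "y = 1 \<or> y = -1"
  shows "reach U x y u < s \<longleftrightarrow> (\<exists>h. 0 < h \<and> h < s \<and> u \<le> climb U x y h)"
  unfolding reach_def using climb_unbounded[OF assms, of u x]
  by (subst cInf_less_iff) (auto intro!: bdd_belowI[of _ 0])

lemma le_reach_iff:
  assumes "y = 1 \<or> y = -1"
  shows "s \<le> reach U x y u \<longleftrightarrow> (\<forall>h. 0 < h \<longrightarrow> h < s \<longrightarrow> climb U x y h < u)"
  using reach_less_iff[OF assms, of x u s] by (meson not_le)

lemma reach_nonneg: "y = 1 \<or> y = -1 \<Longrightarrow> 0 \<le> reach U x y u"
  by (subst le_reach_iff) auto

lemma reach_le: "y = 1 \<or> y = -1 \<Longrightarrow> 0 < h \<Longrightarrow> u \<le> climb U x y h \<Longrightarrow> reach U x y u \<le> h"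
  unfolding reach_def by (rule cInf_lower) (auto intro!: bdd_belowI[of _ 0])

lemma less_reach:
  assumes y: "y = 1 \<or> y = -1" and b: "0 \<le> b" "climb U x y b < u"
  shows "b < reach U x y u"
proof -
  have "continuous (at b within {0..b+1}) (climb U x y)"
    using climb_cont[of "b + 1" x y] b by (simp add: continuous_on_eq_continuous_within)
  then have "eventually (\<lambda>h. climb U x y h < u) (at b within {0..b+1})"
    using b by (simp add: continuous_within order_tendsto_iff)
  then obtain d where d: "d > 0" "\<And>h. h \<in> {0..b+1} \<Longrightarrow> h \<noteq> b \<Longrightarrow> dist h b < d \<Longrightarrow> climb U x y h < u"
    by (auto simp: eventually_at)
  define c where "c = b + min 1 (d / 2)"
  have c: "b < c" "climb U x y c < u"
    using d(1) b(1) by (auto simp: c_def dist_real_def intro!: d(2))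
  have "c \<le> reach U x y u"
    unfolding le_reach_iff[OF y] using c climb_mono by (meson le_less_trans less_imp_le)
  with c show ?thesis by simp
qed

lemma reach_less:
  assumes y: "y = 1 \<or> y = -1" and b: "0 < b" "u < climb U x y b"
  shows "reach U x y u < b"
proof -
  have "continuous (at b within {0..b}) (climb U x y)"
    using climb_cont[of b x y] b by (simp add: continuous_on_eq_continuous_within)
  then have "eventually (\<lambda>h. u < climb U x y h) (at b within {0..b})"
    using b by (simp add: continuous_within order_tendsto_iff)
  then obtain d where d: "d > 0" "\<And>h. h \<in> {0..b} \<Longrightarrow> h \<noteq> b \<Longrightarrow> dist h b < d \<Longrightarrow> u < climb U x y h"
    by (auto simp: eventually_at)
  define c where "c = b - min (b/2) (d / 2)"
  have c: "0 < c" "c < b" "u < climb U x y c"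
    using d(1) b(1) by (auto simp: c_def dist_real_def intro!: d(2))
  then show ?thesis using reach_less_iff[OF y] by (meson less_imp_le)
qed

text \<open>
  No clock runs on the way down, so a process that turned at distance \<open>g\<close> from the bottom starts to
  climb there with an untouched clock. This is the reason why excursions are
  independent. Strict positivity of \<open>u\<close> matters: a clock with value \<open>0\<close> would ring during the descent.
\<close>

lemma reach_after_descent:
  assumes y: "y = 1 \<or> y = -1" and g: "0 \<le> g" and u: "0 < u"
    and down: "\<And>s. 0 \<le> s \<Longrightarrow> s \<le> g \<Longrightarrow> y * deriv U (x + y * s) \<le> 0"
  shows "reach U x y u = g + reach U (x + y * g) y u"
proof -
  have *: "climb U x y h = climb U (x + y * g) y (h - g)" for h
  proof (cases "g \<le> h")
    case True
    have "climb U x y g = 0" using down by (intro climb_eq_0) auto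
    then show ?thesis using climb_split[OF g True] by simp
  next
    case False
    then show ?thesis using climb_eq_0[of h y x] down by simp
  qed
  have "reach U x y u < s \<longleftrightarrow> reach U (x + y * g) y u < s - g" for s
  proof -
    have "(\<exists>h. 0 < h \<and> h < s \<and> u \<le> climb U (x + y * g) y (h - g)) \<longleftrightarrow>
          (\<exists>h. 0 < h \<and> h < s - g \<and> u \<le> climb U (x + y * g) y h)" (is "?L \<longleftrightarrow> ?R")
    proof
      assume ?L
      then obtain h where h: "0 < h" "h < s" "u \<le> climb U (x + y * g) y (h - g)" by auto
      then have "0 < h - g" using u climb_nonpos[of "h - g" "x + y * g" y] by (cases "h \<le> g") auto
      then show ?R using h by (intro exI[of _ "h - g"]) auto
    next
      assume ?R
      then obtain h where h: "0 < h" "h < s - g" "u \<le> climb U (x + y * g) y h" by auto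
      then show ?L using g by (intro exI[of _ "h + g"]) auto
    qed
    then show ?thesis unfolding reach_less_iff[OF y] * .
  qed
  from this[of "reach U x y u"] this[of "reach U (x + y * g) y u + g"] show ?thesis by linarith
qed

text \<open>
  Rewriting the skeleton with \<open>reach\<close> removes the absolute time from the integral: the waiting
  time depends on the current position and velocity only.
\<close>

lemma skeleton_Suc:
  assumes "0 < \<epsilon>" "vjp_skeleton U \<epsilon> x y e i = (T, X, Y)" "Y = 1 \<or> Y = -1"
  shows "vjp_skeleton U \<epsilon> x y e (Suc i) =
    (T + reach U X Y (\<epsilon> * e i), X + Y * reach U X Y (\<epsilon> * e i), - Y)"
proof -
  have *: "integral {T..t} (\<lambda>s. 1 / \<epsilon> * max (Y * deriv U (X + Y * (s - T))) 0) = climb U X Y (t - T) / \<epsilon>" for t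
  proof -
    let ?f = "\<lambda>s. max (Y * deriv U (X + Y * (s - T))) 0"
    have c: "continuous_on S ?f" for S
      by (intro continuous_intros continuous_on_compose2[OF deriv_cont]) auto
    have "integral {T..t} ?f = integral {0..t - T} (?f \<circ> (\<lambda>s. s + T))"
      using integral_shift[where a = 0 and b = "t - T" and c = T and f = ?f] c by simp
    also have "\<dots> = climb U X Y (t - T)" by (simp add: climb_def o_def)
    finally show ?thesis by simp
  qed
  define A where "A = {h. 0 < h \<and> \<epsilon> * e i \<le> climb U X Y h}"
  have A: "A \<noteq> {}" using climb_unbounded[OF assms(3), of "\<epsilon> * e i" X] by (auto simp: A_def)
  have "{t. T < t \<and> integral {T..t} (\<lambda>s. 1 / \<epsilon> * max (Y * deriv U (X + Y * (s - T))) 0) \<ge> e i}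
      = (+) T ` A" (is "?L = _")
  proof (intro set_eqI iffI)
    fix t assume "t \<in> ?L"
    then have "T < t" "e i \<le> climb U X Y (t - T) / \<epsilon>" using *[of t] by auto
    then have "t - T \<in> A" using assms(1) by (simp add: A_def field_simps)
    then show "t \<in> (+) T ` A" by (intro image_eqI[of _ _ "t - T"]) auto
  next
    fix t assume "t \<in> (+) T ` A"
    then show "t \<in> ?L" using assms(1) unfolding * A_def by (auto simp: field_simps)
  qed
  moreover have "Inf ((+) T ` A) = T + Inf A"
  proof (rule cInf_eq_non_empty)
    fix z assume "\<And>t. t \<in> (+) T ` A \<Longrightarrow> z \<le> t"
    then have "z - T \<le> h" if "h \<in> A" for h
      using that by (metis add.commute diff_le_eq image_eqI)
    then have "z - T \<le> Inf A" using A by (intro cInf_greatest) auto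
    then show "z \<le> T + Inf A" by simp
  qed (use A in \<open>auto intro!: cInf_lower bdd_belowI[of _ 0] simp: A_def\<close>)
  ultimately show ?thesis
    using assms(2) by (simp add: reach_def A_def Let_def)
qed

section \<open>Short climbs out of a quadratic well\<close>

text \<open>
  Near the start \<open>climb\<close> behaves like \<open>\<kappa> h\<^sup>2\<close>, and \<open>reach\<close> is its generalised
  inverse, so it behaves like \<open>sqrt (u / \<kappa>)\<close>. Comparing \<open>climb\<close> with \<open>u\<close> at the trial
  length \<open>a * sqrt u\<close> decides on which side of that length the inverse lies.
\<close>

lemma reach_asymptotics:
  assumes y: "y = 1 \<or> y = -1" and \<kappa>: "0 < \<kappa>"
    and lim: "((\<lambda>h. climb U x y h / h\<^sup>2) \<longlongrightarrow> \<kappa>) (at_right 0)"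
  shows "((\<lambda>u. reach U x y u / sqrt u) \<longlongrightarrow> 1 / sqrt \<kappa>) (at_right 0)"
proof -
  have scaled: "((\<lambda>u. climb U x y (a * sqrt u) / u) \<longlongrightarrow> a\<^sup>2 * \<kappa>) (at_right 0)" if "a > 0" for a
  proof -
    have "((\<lambda>u. a * sqrt u) \<longlongrightarrow> a * sqrt 0) (at_right 0)"
      by (intro tendsto_intros)
    then have "filterlim (\<lambda>u. a * sqrt u) (at_right 0) (at_right 0)"
      using that by (auto simp: filterlim_at eventually_at_right_less[of 0] 
          intro!: eventually_mono[OF eventually_at_right_less[of 0]])
    from filterlim_compose[OF lim this]
    have "((\<lambda>u. a\<^sup>2 * (climb U x y (a * sqrt u) / (a * sqrt u)\<^sup>2)) \<longlongrightarrow> a\<^sup>2 * \<kappa>) (at_right 0)"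
      by (intro tendsto_intros)
    then show ?thesis
      by (rule Lim_transform_eventually)
        (use that in \<open>auto simp: power_mult_distrib intro!: eventually_mono[OF eventually_at_right_less[of 0]]\<close>)
  qed
  show ?thesis
  proof (rule order_tendstoI)
    fix a assume a: "a < 1 / sqrt \<kappa>"
    show "eventually (\<lambda>u. a < reach U x y u / sqrt u) (at_right 0)"
    proof (cases "a > 0")
      case True
      then have "a * sqrt \<kappa> < 1" using a \<kappa> by (simp add: field_simps)
      then have "(a * sqrt \<kappa>)\<^sup>2 < 1" using True \<kappa> by (simp add: power_less_one_iff)
      then have "a\<^sup>2 * \<kappa> < 1" using \<kappa> by (simp add: power_mult_distrib)
      from order_tendstoD(2)[OF scaled[OF True] this] eventually_at_right_less[of 0]
      show ?thesis
      proof eventually_elim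
        case (elim u)
        then have "a * sqrt u < reach U x y u" using True by (intro less_reach[OF y]) auto
        then show ?case using elim by (simp add: field_simps)
      qed
    next
      case False
      show ?thesis
        using eventually_at_right_less[of 0]
      proof eventually_elim
        case (elim u)
        then have "0 < reach U x y u" by (intro less_reach[OF y]) auto
        then have "0 < reach U x y u / sqrt u" using elim by simp
        then show ?case using False by linarith
      qed
    qed
  next
    fix a assume a: "1 / sqrt \<kappa> < a"
    have a0: "0 < a" by (rule less_trans[OF _ a]) (use \<kappa> in simp)
    have "1 < a * sqrt \<kappa>" using a \<kappa> by (simp add: field_simps)
    then have "1 < (a * sqrt \<kappa>)\<^sup>2" by (simp add: one_less_power)
    then have "1 < a\<^sup>2 * \<kappa>" using \<kappa> by (simp add: power_mult_distrib)
    from order_tendstoD(1)[OF scaled[OF a0] this] eventually_at_right_less[of 0]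
    show "eventually (\<lambda>u. reach U x y u / sqrt u < a) (at_right 0)"
    proof eventually_elim
      case (elim u)
      then have "reach U x y u < a * sqrt u" using a0 by (intro reach_less[OF y]) (auto simp: field_simps)
      then show ?case using elim by (simp add: field_simps)
    qed
  qed
qed

text \<open>
  For small \<open>u\<close> the bound comes from the asymptotics; for the other heights below
  \<open>climb U x y H\<close> the trivial bound \<open>H\<close> on the distance is of the same form.
\<close>

lemma reach_sqrt_bound:
  assumes y: "y = 1 \<or> y = -1" and \<kappa>: "0 < \<kappa>"
    and lim: "((\<lambda>h. climb U x y h / h\<^sup>2) \<longlongrightarrow> \<kappa>) (at_right 0)" and H: "0 < H"
  shows "\<exists>C\<ge>0. \<forall>u. 0 < u \<longrightarrow> u \<le> climb U x y H \<longrightarrow> reach U x y u \<le> C * sqrt u"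
proof -
  have "eventually (\<lambda>u. reach U x y u / sqrt u < 1 / sqrt \<kappa> + 1) (at_right 0)"
    by (rule order_tendstoD(2)[OF reach_asymptotics[OF y \<kappa> lim]]) simp
  then obtain b where b: "b > 0" "\<And>u. 0 < u \<Longrightarrow> u < b \<Longrightarrow> reach U x y u / sqrt u < 1 / sqrt \<kappa> + 1"
    by (auto simp: eventually_at_right_field)
  let ?C = "max (1 / sqrt \<kappa> + 1) (H / sqrt b)"
  have "reach U x y u \<le> ?C * sqrt u" if u: "0 < u" "u \<le> climb U x y H" for u
  proof (cases "u < b")
    case True
    then have "reach U x y u \<le> (1 / sqrt \<kappa> + 1) * sqrt u" using b(2)[of u] u by (simp add: field_simps)
    also have "\<dots> \<le> ?C * sqrt u" using u by (intro mult_right_mono) auto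
    finally show ?thesis .
  next
    case False
    have "reach U x y u \<le> H" using reach_le[OF y H u(2)] .
    also have "\<dots> \<le> H / sqrt b * sqrt u" using False b(1) H u by (simp add: field_simps)
    also have "\<dots> \<le> ?C * sqrt u" using u by (intro mult_right_mono) auto
    finally show ?thesis .
  qed
  moreover have "0 \<le> ?C" using \<kappa> by (simp add: le_max_iff_disj)
  ultimately show ?thesis by blast
qed

end

section \<open>The shape of a double well\<close>

lemma second_derivative_test_min:
  fixes f f' :: "real \<Rightarrow> real"
  assumes "\<And>x. (f has_real_derivative f' x) (at x)"
    and "(f' has_real_derivative l) (at c)" "f' c = 0" "0 < l"
  shows "\<forall>\<^sub>F y in nhds c. f c \<le> f y"
proof -
  obtain d1 where d1: "d1 > 0" "\<And>h. 0 < h \<Longrightarrow> h < d1 \<Longrightarrow> 0 < f' (c + h)"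
    using DERIV_pos_inc_right[OF assms(2,4)] assms(3) by auto
  obtain d2 where d2: "d2 > 0" "\<And>h. 0 < h \<Longrightarrow> h < d2 \<Longrightarrow> f' (c - h) < 0"
    using DERIV_pos_inc_left[OF assms(2,4)] assms(3) by auto
  have "f c \<le> f y" if y: "dist y c < min d1 d2" for y
  proof (cases "c \<le> y")
    case True
    have "0 \<le> f' z" if z: "c \<le> z" "z \<le> y" for z
      using d1(2)[of "z - c"] z y assms(3) by (cases "z = c") (auto simp: dist_real_def)
    then show ?thesis
      using DERIV_nonneg_imp_nondecreasing[OF True, of f] assms(1) by blast
  next
    case False
    have "f' z \<le> 0" if z: "y \<le> z" "z \<le> c" for z
      using d2(2)[of "c - z"] z y assms(3) by (cases "z = c") (auto simp: dist_real_def)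
    then show ?thesis
      using DERIV_nonpos_imp_nonincreasing[of y c f] False assms(1) by fastforce
  qed
  then show ?thesis
    unfolding eventually_nhds_metric using d1(1) d2(1) by (intro exI[of _ "min d1 d2"]) auto
qed

locale double_well_potential =
  fixes U :: "real \<Rightarrow> real" and x0 x1 x2 :: real
  assumes double_well: "double_well U x0 x1 x2"
begin

lemma U_deriv: "(U has_real_derivative deriv U x) (at x)"
  and U_deriv2: "(deriv U has_real_derivative deriv (deriv U) x) (at x)"
proof -
  have "((deriv ^^ n) U) differentiable (at x)" for n
    using double_well by (simp add: double_well_def smooth_def)
  from this[of 0] this[of 1] show "(U has_real_derivative deriv U x) (at x)"
    "(deriv U has_real_derivative deriv (deriv U) x) (at x)"
    using real_differentiableE DERIV_imp_deriv by (metis funpow_0, metis One_nat_def funpow_0 funpow_Suc_right o_apply)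
qed

sublocale coercive_potential U
proof
  show "continuous_on UNIV (deriv U)"
    using U_deriv2 by (intro DERIV_continuous_on) (auto intro: has_field_derivative_at_within)
qed (use double_well U_deriv in \<open>auto simp: double_well_def\<close>)

lemma x01: "x0 < x1" and x12: "x1 < x2"
  using double_well by (auto simp: double_well_def)

text \<open>
  The nondegeneracy of critical points makes the sign of the second derivative decide their type,
  so there are no critical points besides the three given ones.
\<close>

lemma critical_max: "deriv U x = 0 \<Longrightarrow> deriv (deriv U) x < 0 \<Longrightarrow> x = x1"
proof -
  assume crit: "deriv U x = 0" and neg: "deriv (deriv U) x < 0"
  have "\<forall>\<^sub>F y in nhds x. - U x \<le> - U y"
    by (rule second_derivative_test_min[where f' = "\<lambda>x. - deriv U x" and l = "- deriv (deriv U) x"])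
      (use crit neg in \<open>auto intro!: DERIV_minus U_deriv U_deriv2\<close>)
  then have "is_local_max U x" by (simp add: is_local_max_def)
  then show ?thesis using double_well by (auto simp: double_well_def)
qed

lemma critical_point_cases:
  assumes crit: "deriv U x = 0"
  shows "x = x0 \<or> x = x1 \<or> x = x2"
proof (cases "0 < deriv (deriv U) x")
  case True
  have "is_local_min U x"
    unfolding is_local_min_def by (rule second_derivative_test_min[OF U_deriv U_deriv2 crit True])
  then show ?thesis using double_well by (auto simp: double_well_def)
next
  case False
  moreover have "deriv (deriv U) x \<noteq> 0"
    using crit double_well by (auto simp: double_well_def morse_def)
  ultimately show ?thesis using critical_max[OF crit] by linarith
qed

lemma deriv_x0: "deriv U x0 = 0"
proof -
  have "is_local_min U x0" using double_well by (auto simp: double_well_def)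
  then obtain d where "d > 0" "\<And>y. dist y x0 < d \<Longrightarrow> U x0 \<le> U y"
    by (auto simp: is_local_min_def eventually_nhds_metric)
  then show ?thesis
    by (intro DERIV_local_min[OF U_deriv, of d]) (auto simp: dist_real_def abs_minus_commute)
qed

lemma curvature_pos: "0 < deriv (deriv U) x0"
proof -
  have "deriv (deriv U) x0 \<noteq> 0" using deriv_x0 double_well by (auto simp: double_well_def morse_def)
  moreover have "\<not> deriv (deriv U) x0 < 0" using critical_max[OF deriv_x0] x01 by auto
  ultimately show ?thesis by linarith
qed

lemma deriv_cont_on: "continuous_on S (deriv U)"
  using deriv_cont by (rule continuous_on_subset) auto

lemma U_cont_on: "continuous_on S U"
  using has_field_derivative_at_within[OF U_deriv] by (rule DERIV_continuous_on)

text \<open>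
  A positive derivative left of \<open>x0\<close> would stay positive, for lack of zeros, all the way to the left
  and contradict coercivity.
\<close>

lemma deriv_left: assumes "x < x0" shows "deriv U x < 0"
proof (rule ccontr)
  assume "\<not> deriv U x < 0"
  moreover have nz: "deriv U z \<noteq> 0" if "z \<le> x" for z
    using critical_point_cases[of z] that assms x01 x12 by auto
  ultimately have pos: "0 < deriv U x" using nz[of x] by linarith
  have "0 < deriv U z" if zx: "z \<le> x" for z
  proof (rule ccontr)
    assume "\<not> 0 < deriv U z"
    then obtain w where "z \<le> w" "w \<le> x" "deriv U w = 0"
      using IVT'[of "deriv U" z 0 x] zx pos deriv_cont_on by auto
    then show False using nz[of w] by auto
  qed
  then have le: "U z \<le> U x" if "z \<le> x" for z
    using DERIV_nonneg_imp_nondecreasing[OF that, of U] U_deriv by (meson less_imp_le)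
  have "eventually (\<lambda>z. U x < U z \<and> z \<le> x) at_bot"
    using coercive(2) by (intro eventually_conj eventually_le_at_bot) (auto simp: filterlim_at_top_dense)
  from eventually_happens'[OF _ this] le show False by fastforce
qed

lemma deriv_right: assumes "x0 < x" "x < x1" shows "0 < deriv U x"
proof (rule ccontr)
  assume neg: "\<not> 0 < deriv U x"
  obtain d where d: "d > 0" "\<And>h. 0 < h \<Longrightarrow> h < d \<Longrightarrow> 0 < deriv U (x0 + h)"
    using DERIV_pos_inc_right[OF U_deriv2 curvature_pos] deriv_x0 by auto
  define z where "z = x0 + min (d/2) ((x - x0)/2)"
  have z: "x0 < z" "z \<le> x"
    using d(1) assms(1) by (auto simp: z_def min_def field_simps)
  have "0 < deriv U z"
    using d(1) assms(1) unfolding z_def by (intro d(2)) auto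
  then obtain w where w: "z \<le> w" "w \<le> x" "deriv U w = 0"
    using IVT2'[of "deriv U" x 0 z] neg z deriv_cont_on by auto
  then show False using critical_point_cases[of w] z assms x12 w by auto
qed

lemma deriv_left_le: "x \<le> x0 \<Longrightarrow> deriv U x \<le> 0"
  using deriv_left[of x] deriv_x0 by (cases "x = x0") auto

lemma deriv_x1: "deriv U x1 = 0"
proof -
  have "is_local_max U x1" using double_well by (auto simp: double_well_def)
  then obtain d where "d > 0" "\<And>y. dist y x1 < d \<Longrightarrow> U y \<le> U x1"
    by (auto simp: is_local_max_def eventually_nhds_metric)
  then show ?thesis
    by (intro DERIV_local_max[OF U_deriv, of d]) (auto simp: dist_real_def abs_minus_commute)
qed

lemma deriv_right_ge: "x0 \<le> x \<Longrightarrow> x \<le> x1 \<Longrightarrow> 0 \<le> deriv U x"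
  using deriv_right[of x] deriv_x0 deriv_x1 by (cases "x = x0"; cases "x = x1") auto

lemma climb_left: "0 \<le> h \<Longrightarrow> climb U x0 (-1) h = U (x0 - h) - U x0"
  using climb_eq_rise[of h "-1" x0] deriv_left_le by simp

lemma climb_right: "0 \<le> h \<Longrightarrow> h \<le> x1 - x0 \<Longrightarrow> climb U x0 1 h = U (x0 + h) - U x0"
  using climb_eq_rise[of h 1 x0] deriv_right_ge by simp

text \<open>
  The work counts the height above \<open>x0\<close> on both sides, so this is the second-order Taylor expansion of
  \<open>U\<close> at its minimum, obtained from the rule of de l'Hopital.
\<close>

lemma climb_quadratic:
  assumes y: "y = 1 \<or> y = -1"
  shows "((\<lambda>h. climb U x0 y h / h\<^sup>2) \<longlongrightarrow> deriv (deriv U) x0 / 2) (at_right 0)"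
proof -
  have "((\<lambda>h. y * deriv U (x0 + y * h)) has_real_derivative y * (deriv (deriv U) (x0 + y * 0) * y)) (at 0 within {0<..})"
    by (rule DERIV_cmult, rule DERIV_chain2[OF U_deriv2]) (auto intro!: derivative_eq_intros)
  then have "((\<lambda>h. y * deriv U (x0 + y * h) / h) \<longlongrightarrow> deriv (deriv U) x0) (at_right 0)"
    using y by (auto simp: has_field_derivative_iff deriv_x0)
  from tendsto_divide[OF this tendsto_const[of 2]]
  have lim: "((\<lambda>h. (y * deriv U (x0 + y * h)) / (2 * h)) \<longlongrightarrow> deriv (deriv U) x0 / 2) (at_right 0)"
    by (simp add: mult.commute)
  have small: "eventually (\<lambda>h. 0 < h \<and> h < x1 - x0) (at_right 0)"
    using x01 by (simp add: eventually_at_right_field) (metis diff_gt_0_iff_gt)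
  have "((\<lambda>h. (U (x0 + y * h) - U x0) / h\<^sup>2) \<longlongrightarrow> deriv (deriv U) x0 / 2) (at_right 0)"
  proof (rule lhopital_right_0[OF _ _ _ _ _ _ lim])
    have "isCont U x0" using U_deriv DERIV_isCont by blast
    moreover have "((\<lambda>h. x0 + y * h) \<longlongrightarrow> x0 + y * 0) (at_right 0)" by (intro tendsto_intros)
    ultimately have "((\<lambda>h. U (x0 + y * h)) \<longlongrightarrow> U x0) (at_right 0)"
      using isCont_tendsto_compose[of x0 U] by simp
    then show "((\<lambda>h. U (x0 + y * h) - U x0) \<longlongrightarrow> 0) (at_right 0)"
      by (simp add: LIM_zero)
    have "((\<lambda>h::real. h\<^sup>2) \<longlongrightarrow> 0\<^sup>2) (at_right 0)" by (intro tendsto_intros)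
    then show "((\<lambda>h::real. h\<^sup>2) \<longlongrightarrow> 0) (at_right 0)" by simp
    show "eventually (\<lambda>h::real. h\<^sup>2 \<noteq> 0) (at_right 0)" "eventually (\<lambda>h::real. 2 * h \<noteq> 0) (at_right 0)"
      using eventually_at_right_less[of 0] by (auto elim!: eventually_mono)
    show "eventually (\<lambda>h. ((\<lambda>h. U (x0 + y * h) - U x0) has_real_derivative y * deriv U (x0 + y * h)) (at h)) (at_right 0)"
      using has_deriv_along[of x0 y _ UNIV] by (auto intro!: always_eventually derivative_eq_intros)
    show "eventually (\<lambda>h. ((\<lambda>h::real. h\<^sup>2) has_real_derivative 2 * h) (at h)) (at_right 0)"
      by (auto intro!: always_eventually derivative_eq_intros)
  qed
  then show ?thesis
    by (rule Lim_transform_eventually)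
      (use y climb_left climb_right in \<open>auto intro!: eventually_mono[OF small]\<close>)
qed

text \<open>
  Beyond the distance \<open>1\<close>, convexity lets the height grow at least linearly, which bounds the distance by a
  multiple of \<open>u\<close>. The bound has to hold for all heights because left excursions are unbounded.
\<close>

lemma reach_left_bound: "\<exists>C\<ge>0. \<forall>u>0. reach U x0 (-1) u \<le> C * (sqrt u + u)"
proof -
  obtain C where C: "C \<ge> 0" "\<And>u. 0 < u \<Longrightarrow> u \<le> climb U x0 (-1) 1 \<Longrightarrow> reach U x0 (-1) u \<le> C * sqrt u"
    using reach_sqrt_bound[OF _ _ climb_quadratic[of "-1"], of 1] curvature_pos by auto
  define m where "m = climb U x0 (-1) 1"
  have "U x0 < U (x0 - 1)"
    by (rule DERIV_neg_imp_decreasing_open[of "x0 - 1" x0 U])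
      (use U_deriv deriv_left U_cont_on in auto)
  then have m: "0 < m" by (simp add: m_def climb_left)
  have "reach U x0 (-1) u \<le> max C (1/m) * (sqrt u + u)" if u: "0 < u" for u
  proof (cases "u \<le> m")
    case True
    then have "reach U x0 (-1) u \<le> C * sqrt u" using C(2)[OF u] by (simp add: m_def)
    also have "\<dots> \<le> max C (1/m) * (sqrt u + u)" using u C(1) by (intro mult_mono) (auto simp: le_max_iff_disj)
    finally show ?thesis .
  next
    case False
    define h where "h = u / m"
    have h: "1 < h" using False m by (simp add: h_def)
    have "convex_on {..x0} U" using double_well by (simp add: double_well_def)
    from convex_onD[OF this, of "1/h" x0 "x0 - h"] h
    have "U ((1 - 1/h) * x0 + 1/h * (x0 - h)) \<le> (1 - 1/h) * U x0 + 1/h * U (x0 - h)" by simp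
    moreover have "(1 - 1/h) * x0 + 1/h * (x0 - h) = x0 - 1" using h by (simp add: field_simps)
    ultimately have "U (x0 - 1) \<le> (1 - 1/h) * U x0 + 1/h * U (x0 - h)" by simp
    then have "h * m \<le> climb U x0 (-1) h" using h by (simp add: m_def climb_left field_simps)
    then have "reach U x0 (-1) u \<le> h" using h m by (intro reach_le) (auto simp: h_def)
    also have "\<dots> = 1/m * u" by (simp add: h_def)
    also have "\<dots> \<le> max C (1/m) * (sqrt u + u)" using u m C(1) by (intro mult_mono) (auto simp: le_max_iff_disj)
    finally show ?thesis .
  qed
  moreover have "0 \<le> max C (1/m)" using C(1) by (simp add: le_max_iff_disj)
  ultimately show ?thesis by blast
qed

lemma reach_right_bound: "\<exists>C\<ge>0. \<forall>u. 0 < u \<longrightarrow> u < U x1 - U x0 \<longrightarrow> reach U x0 1 u \<le> C * (sqrt u + u)"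
proof -
  obtain C where C: "C \<ge> 0" "\<And>u. 0 < u \<Longrightarrow> u \<le> climb U x0 1 (x1 - x0) \<Longrightarrow> reach U x0 1 u \<le> C * sqrt u"
    using reach_sqrt_bound[OF _ _ climb_quadratic[of 1], of "x1 - x0"] curvature_pos x01 by auto
  have "reach U x0 1 u \<le> C * (sqrt u + u)" if "0 < u" "u < U x1 - U x0" for u
    using C(2)[of u] that mult_nonneg_nonneg[OF C(1), of u] x01
    by (auto simp: climb_right distrib_left intro: add_increasing2)
  with C(1) show ?thesis by blast
qed

lemma reach_right_less: "u < U x1 - U x0 \<Longrightarrow> reach U x0 1 u < x1 - x0"
  using x01 by (intro reach_less) (auto simp: climb_right)

lemma less_reach_right: "U x1 - U x0 < u \<Longrightarrow> x1 - x0 < reach U x0 1 u"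
  using x01 by (intro less_reach) (auto simp: climb_right)

lemma barrier_pos: "U x0 < U x1"
  by (rule DERIV_pos_imp_increasing_open[OF x01, of U])
    (use U_deriv deriv_right U_cont_on in auto)

end

section \<open>Trajectories of the velocity jump process and measurability of hitting times\<close>

context coercive_potential
begin

text \<open>
  The infimum over reals can be tested on rationals since \<open>climb\<close> is monotone in the length, and it
  is continuous in the starting point.
\<close>

lemma reach_measurable:
  assumes [measurable]: "f \<in> borel_measurable M" "g \<in> borel_measurable M" and v: "v = 1 \<or> v = -1"
  shows "(\<lambda>\<omega>. reach U (f \<omega>) v (g \<omega>)) \<in> borel_measurable M"
proof (rule borel_measurableI_less)
  fix s
  have [measurable]: "(\<lambda>x. climb U x v h) \<in> borel_measurable borel" for h
    by (rule borel_measurable_continuous_onI[OF climb_cont_start])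
  have *: "reach U (f \<omega>) v (g \<omega>) < s \<longleftrightarrow>
      (\<exists>q::rat. 0 < q \<and> of_rat q < s \<and> g \<omega> \<le> climb U (f \<omega>) v (of_rat q))" for \<omega>
    unfolding reach_less_iff[OF v]
  proof safe
    fix h assume h: "0 < h" "h < s" "g \<omega> \<le> climb U (f \<omega>) v h"
    obtain q where "h < of_rat q" "of_rat q < s" using of_rat_dense[OF h(2)] by blast
    then show "\<exists>q::rat. 0 < q \<and> of_rat q < s \<and> g \<omega> \<le> climb U (f \<omega>) v (of_rat q)"
      using h climb_mono[of h "of_rat q" "f \<omega>" v]
      by (intro exI[of _ q]) (auto simp: zero_less_of_rat_iff[symmetric, where 'a=real] simp del: zero_less_of_rat_iff)
  qed (use zero_less_of_rat_iff in blast)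
  show "{\<omega> \<in> space M. reach U (f \<omega>) v (g \<omega>) < s} \<in> sets M"
    unfolding * by measurable
qed

context
  fixes \<epsilon> x y :: real
  assumes eps: "0 < \<epsilon>" and y: "y = 1 \<or> y = -1"
begin

definition jump_pos :: "(nat \<Rightarrow> real) \<Rightarrow> nat \<Rightarrow> real" where
  "jump_pos e i = fst (snd (vjp_skeleton U \<epsilon> x y e i))"

definition velocity :: "nat \<Rightarrow> real" where
  "velocity i = y * (-1) ^ i"

lemma velocity_cases: "velocity i = 1 \<or> velocity i = -1"
  using y by (cases "even i") (auto simp: velocity_def)

lemma skeleton_eq: "vjp_skeleton U \<epsilon> x y e i = (vjp_time U \<epsilon> x y e i, jump_pos e i, velocity i)"
proof (induction i)
  case 0
  show ?case by (simp add: vjp_time_def jump_pos_def velocity_def)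
next
  case (Suc i)
  from skeleton_Suc[OF eps Suc velocity_cases] show ?case
    by (simp add: vjp_time_def jump_pos_def velocity_def)
qed

lemma time_0 [simp]: "vjp_time U \<epsilon> x y e 0 = 0" and pos_0 [simp]: "jump_pos e 0 = x"
  by (auto simp: vjp_time_def jump_pos_def)

lemma time_Suc: "vjp_time U \<epsilon> x y e (Suc i) =
    vjp_time U \<epsilon> x y e i + reach U (jump_pos e i) (velocity i) (\<epsilon> * e i)"
  and pos_Suc: "jump_pos e (Suc i) =
    jump_pos e i + velocity i * reach U (jump_pos e i) (velocity i) (\<epsilon> * e i)"
  using skeleton_Suc[OF eps skeleton_eq velocity_cases, of e i] skeleton_eq[of e "Suc i"] by auto

lemma time_mono: "incseq (vjp_time U \<epsilon> x y e)"
  by (rule incseq_SucI) (simp add: time_Suc reach_nonneg[OF velocity_cases])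

lemma vjp_between_jumps:
  assumes "vjp_time U \<epsilon> x y e i \<le> t" "t < vjp_time U \<epsilon> x y e (Suc i)"
  shows "fst (vjp U \<epsilon> x y e t) = jump_pos e i + velocity i * (t - vjp_time U \<epsilon> x y e i)"
proof -
  have "(THE i. vjp_time U \<epsilon> x y e i \<le> t \<and> t < vjp_time U \<epsilon> x y e (Suc i)) = i"
  proof (rule the_equality)
    fix j assume j: "vjp_time U \<epsilon> x y e j \<le> t \<and> t < vjp_time U \<epsilon> x y e (Suc j)"
    have "\<not> Suc i \<le> j" "\<not> Suc j \<le> i"
      using incseqD[OF time_mono, of "Suc i" j e] incseqD[OF time_mono, of "Suc j" i e] j assms by linarith+
    then show "j = i" by simp
  qed (use assms in auto)
  then show ?thesis by (simp add: vjp_def Let_def skeleton_eq)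
qed

lemma vjp_after_jumps:
  assumes "\<And>i. vjp_time U \<epsilon> x y e i \<le> t"
  shows "fst (vjp U \<epsilon> x y e t) = (let i = (THE i. False) in
    jump_pos e i + velocity i * (t - vjp_time U \<epsilon> x y e i))"
proof -
  have "(\<lambda>i. vjp_time U \<epsilon> x y e i \<le> t \<and> t < vjp_time U \<epsilon> x y e (Suc i)) = (\<lambda>i. False)"
    using assms by (intro ext) (meson not_less)
  then show ?thesis by (simp add: vjp_def Let_def skeleton_eq)
qed

lemma jump_index:
  assumes "0 \<le> t" "t < vjp_time U \<epsilon> x y e n"
  shows "\<exists>i<n. vjp_time U \<epsilon> x y e i \<le> t \<and> t < vjp_time U \<epsilon> x y e (Suc i)"
  using assms(2)
proof (induction n)
  case (Suc n)
  then show ?case by (cases "t < vjp_time U \<epsilon> x y e n") (auto simp: less_Suc_eq)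
qed (use assms(1) in simp)

text \<open>
  The only time at which the straight line through the \<open>i\<close>-th point of the skeleton meets \<open>a\<close>.
\<close>

definition crossing :: "real \<Rightarrow> (nat \<Rightarrow> real) \<Rightarrow> nat \<Rightarrow> real" where
  "crossing a e i = vjp_time U \<epsilon> x y e i + velocity i * (a - jump_pos e i)"

lemma crossing_iff: "jump_pos e i + velocity i * (t - vjp_time U \<epsilon> x y e i) = a \<longleftrightarrow> t = crossing a e i"
  using velocity_cases[of i] by (auto simp: crossing_def)

text \<open>
  An expression by countably many measurable functions of the clocks, valid for every realisation, including
  those with nonpositive clocks or accumulating jump times. The last term accounts for times
  beyond an accumulation point, where the trajectory continues along the line given by the index
  \<open>THE i. False\<close>.
\<close>

lemma hitting_time_eq:
  "hitting_time (\<lambda>t. fst (vjp U \<epsilon> x y e t)) a =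
    min (INF i. if 0 < crossing a e i \<and> vjp_time U \<epsilon> x y e i \<le> crossing a e i \<and>
                   crossing a e i < vjp_time U \<epsilon> x y e (Suc i)
                then ennreal (crossing a e i) else \<infinity>)
        (let c = crossing a e (THE i. False) in
           if 0 < c \<and> (\<forall>i. vjp_time U \<epsilon> x y e i \<le> c) then ennreal c else \<infinity>)"
    (is "_ = min (INF i. ?f i) ?g")
proof -
  let ?c = "crossing a e (THE i. False)"
  show ?thesis
  proof (rule antisym)
    have "hitting_time (\<lambda>t. fst (vjp U \<epsilon> x y e t)) a \<le> ?f i" for i
      unfolding hitting_time_def
      by (auto intro!: Inf_lower simp: vjp_between_jumps crossing_iff)
    moreover have "hitting_time (\<lambda>t. fst (vjp U \<epsilon> x y e t)) a \<le> ?g"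
    proof (cases "0 < ?c \<and> (\<forall>i. vjp_time U \<epsilon> x y e i \<le> ?c)")
      case True
      then have "fst (vjp U \<epsilon> x y e ?c) = a"
        using vjp_after_jumps[of e ?c] crossing_iff[of e "THE i. False" ?c a] by (simp add: Let_def)
      then show ?thesis
        using True unfolding hitting_time_def by (auto simp: Let_def intro!: Inf_lower)
    next
      case False
      then show ?thesis by (auto simp: Let_def)
    qed
    ultimately show "hitting_time (\<lambda>t. fst (vjp U \<epsilon> x y e t)) a \<le> min (INF i. ?f i) ?g"
      by (intro min.boundedI INF_greatest) auto
    show "min (INF i. ?f i) ?g \<le> hitting_time (\<lambda>t. fst (vjp U \<epsilon> x y e t)) a"
      unfolding hitting_time_def
    proof (rule Inf_greatest)
      fix z assume "z \<in> {ennreal t |t. 0 < t \<and> fst (vjp U \<epsilon> x y e t) = a}"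
      then obtain t where z: "z = ennreal t" and t: "0 < t" "fst (vjp U \<epsilon> x y e t) = a"
        by auto
      show "min (INF i. ?f i) ?g \<le> z"
      proof (cases "\<forall>i. vjp_time U \<epsilon> x y e i \<le> t")
        case True
        then have "jump_pos e (THE i. False) + velocity (THE i. False) *
            (t - vjp_time U \<epsilon> x y e (THE i. False)) = a"
          using t(2) vjp_after_jumps[of e t] by (simp add: Let_def)
        then have "t = ?c" by (rule iffD1[OF crossing_iff])
        then have "?g = ennreal t" using True t(1) by (simp add: Let_def)
        then have "?g \<le> z" unfolding z by (rule eq_refl)
        then show ?thesis by (rule min.coboundedI2)
      next
        case False
        then obtain n where "t < vjp_time U \<epsilon> x y e n" by (auto simp: not_le)
        with t(1) obtain i where i: "vjp_time U \<epsilon> x y e i \<le> t" "t < vjp_time U \<epsilon> x y e (Suc i)"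
          using jump_index[of t e n] by auto
        then have "t = crossing a e i"
          using t(2) vjp_between_jumps[OF i] crossing_iff[of e i t a] by simp
        then have "?f i = ennreal t" using i t(1) by auto
        then have "(INF i. ?f i) \<le> z" using INF_lower[of i UNIV ?f] unfolding z by simp
        then show ?thesis by (rule min.coboundedI1)
      qed
    qed
  qed
qed

lemma hitting_time_measurable:
  assumes E: "\<And>i. E i \<in> borel_measurable M"
  shows "(\<lambda>\<omega>. hitting_time (\<lambda>t. fst (vjp U \<epsilon> x y (\<lambda>i. E i \<omega>) t)) a) \<in> borel_measurable M"
proof -
  have "(\<lambda>\<omega>. jump_pos (\<lambda>i. E i \<omega>) i) \<in> borel_measurable M \<and>
        (\<lambda>\<omega>. vjp_time U \<epsilon> x y (\<lambda>i. E i \<omega>) i) \<in> borel_measurable M" for i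
  proof (induction i)
    case (Suc i)
    then have "(\<lambda>\<omega>. reach U (jump_pos (\<lambda>i. E i \<omega>) i) (velocity i) (\<epsilon> * E i \<omega>)) \<in> borel_measurable M"
      using E by (intro reach_measurable velocity_cases) auto
    with Suc show ?case by (auto simp: time_Suc pos_Suc)
  qed simp
  then have [measurable]: "(\<lambda>\<omega>. jump_pos (\<lambda>i. E i \<omega>) i) \<in> borel_measurable M"
    "(\<lambda>\<omega>. vjp_time U \<epsilon> x y (\<lambda>i. E i \<omega>) i) \<in> borel_measurable M" for i
    by auto
  have [measurable]: "(\<lambda>\<omega>. crossing a (\<lambda>i. E i \<omega>) i) \<in> borel_measurable M" for i
    unfolding crossing_def by measurable
  show ?thesis
    unfolding hitting_time_eq Let_def by measurable
qed

end

end

section \<open>The hitting time of the barrier as a sum of excursions\<close>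

context double_well_potential
begin

text \<open>
  The excursion length fixed by clock \<open>i\<close>: the process starts to the left, so the even clocks belong to the
  left side.
\<close>

definition ascent :: "real \<Rightarrow> (nat \<Rightarrow> real) \<Rightarrow> nat \<Rightarrow> real" where
  "ascent \<epsilon> e i = reach U x0 (if even i then -1 else 1) (\<epsilon> * e i)"

text \<open>
  Until the first odd clock above the barrier height, the process turns alternately at the distances
  \<open>ascent \<epsilon> e 0\<close>, \<open>ascent \<epsilon> e 1\<close>, \<dots> from \<open>x0\<close>. When that clock starts, each of these distances has been
  travelled twice, except that the last return is still ahead; adding this return and the climb of length
  \<open>x1 - x0\<close> gives the hitting time.
\<close>

lemma hitting_time_well:
  assumes eps: "0 < \<epsilon>" and pos: "\<And>i. 0 < e i"
    and low: "\<And>j. j < k \<Longrightarrow> \<epsilon> * e (2 * j + 1) < U x1 - U x0"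
    and high: "U x1 - U x0 < \<epsilon> * e (2 * k + 1)"
  shows "hitting_time (\<lambda>t. fst (vjp U \<epsilon> x0 (-1) e t)) x1 =
    ennreal (x1 - x0 + 2 * (\<Sum>j<2 * k + 1. ascent \<epsilon> e j))"
proof -
  let ?T = "vjp_time U \<epsilon> x0 (-1) e" and ?X = "jump_pos \<epsilon> x0 (-1) e" and ?v = "velocity (-1)"
  have y: "(-1::real) = 1 \<or> (-1::real) = -1" by simp
  define d where "d = ascent \<epsilon> e"
  \<comment> \<open>The distance from \<open>x0\<close> at the \<open>n\<close>-th jump.\<close>
  define g where "g n = (case n of 0 \<Rightarrow> 0 | Suc m \<Rightarrow> d m)" for n
  have d_nonneg: "0 \<le> d n" for n by (simp add: d_def ascent_def reach_nonneg)
  have g_nonneg: "0 \<le> g n" for n by (cases n) (auto simp: g_def d_nonneg)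
  have v: "?v n = (if even n then -1 else 1)" for n by (simp add: velocity_def[OF eps y])
  have d_less: "d n < x1 - x0" if "odd n" "n < 2 * k + 1" for n
  proof -
    obtain j where j: "n = 2 * j + 1" using \<open>odd n\<close> by (auto elim: oddE)
    then show ?thesis using low[of j] that by (simp add: d_def ascent_def reach_right_less)
  qed
  have g_less: "g n < x1 - x0" if "even n" "n \<le> 2 * k + 1" for n
    using that x01 d_less[of "n - 1"] by (cases n) (auto simp: g_def)
  \<comment> \<open>Each leg consists of the return to \<open>x0\<close> and of a climb on the other side.\<close>
  have step: "reach U (x0 - ?v n * g n) (?v n) (\<epsilon> * e n) = g n + d n" if "n \<le> 2 * k + 1" for n
  proof -
    have "?v n * deriv U (x0 - ?v n * g n + ?v n * s) \<le> 0" if s: "0 \<le> s" "s \<le> g n" for s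
    proof (cases "even n")
      case True
      then show ?thesis using g_less[OF True \<open>n \<le> 2 * k + 1\<close>] s by (auto simp: v intro!: deriv_right_ge)
    next
      case False
      then show ?thesis using s by (auto simp: v intro!: deriv_left_le)
    qed
    then show ?thesis
      using reach_after_descent[of "?v n" "g n" "\<epsilon> * e n" "x0 - ?v n * g n"] g_nonneg[of n] pos[of n] eps
      by (simp add: d_def ascent_def v)
  qed
  have skel: "?X n = x0 - ?v n * g n \<and> ?T n = 2 * (\<Sum>j<n. d j) - g n" if "n \<le> 2 * k + 2" for n
    using that
  proof (induction n)
    case 0
    then show ?case by (simp add: g_def pos_0[OF eps y] time_0[OF eps y])
  next
    case (Suc n)
    then have X: "?X n = x0 - ?v n * g n" and T: "?T n = 2 * (\<Sum>j<n. d j) - g n" and n: "n \<le> 2 * k + 1" by auto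
    show ?case
      using step[OF n] by (simp add: pos_Suc[OF eps y] time_Suc[OF eps y] X T) (simp add: g_def v)
  qed
  define H where "H = x1 - x0"
  define \<tau> where "\<tau> = H + 2 * (\<Sum>j<2 * k + 1. d j)"
  have H: "0 < H" using x01 by (simp add: H_def)
  have last_T: "\<tau> = ?T (2 * k + 1) + g (2 * k + 1) + H"
    using skel[of "2 * k + 1"] by (simp add: \<tau>_def)
  \<comment> \<open>The barrier is reached strictly before the next jump, because the clock strictly exceeds its height.\<close>
  have "\<tau> < ?T (2 * k + 2)"
  proof -
    have "H < d (2 * k + 1)" using less_reach_right[OF high] by (simp add: d_def ascent_def H_def)
    then show ?thesis
      using time_Suc[OF eps y, of x0 e "2 * k + 1"] step[of "2 * k + 1"] skel[of "2 * k + 1"]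
      by (simp add: last_T)
  qed
  have pos_\<tau>: "0 < \<tau>" using H sum_nonneg[of "{..<2*k+1}" d] d_nonneg by (simp add: \<tau>_def)
  have "fst (vjp U \<epsilon> x0 (-1) e \<tau>) = x1"
    using vjp_between_jumps[OF eps y, of x0 e "2 * k + 1" \<tau>] \<open>\<tau> < ?T (2 * k + 2)\<close> last_T g_nonneg[of "2*k+1"] H
      skel[of "2 * k + 1"] by (simp add: v H_def)
  \<comment> \<open>All earlier legs stay strictly to the left of \<open>x1\<close>.\<close>
  moreover have "\<tau> \<le> t" if t: "0 < t" "fst (vjp U \<epsilon> x0 (-1) e t) = x1" for t
  proof (rule ccontr)
    assume less: "\<not> \<tau> \<le> t"
    then obtain n where n: "n < 2 * k + 2" "?T n \<le> t" "t < ?T (Suc n)"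
      using jump_index[OF eps y, of t x0 e "2 * k + 2"] \<open>\<tau> < ?T (2 * k + 2)\<close> t(1) by auto
    then have n': "n \<le> 2 * k + 1" by simp
    have X: "x1 = x0 - ?v n * g n + ?v n * (t - ?T n)"
      using vjp_between_jumps[OF eps y n(2,3)] t(2) skel[of n] n(1) by simp
    show False
    proof (cases "even n")
      case True
      then show False using X g_less[OF True n'] n(2) by (simp add: v)
    next
      case False
      then have X1: "x1 = x0 - g n + (t - ?T n)" using X by (simp add: v)
      show False
      proof (cases "n = 2 * k + 1")
        case True
        then show False using X1 less last_T by (simp add: H_def)
      next
        case n2: False
        have "t - ?T n < g n + d n"
          using n(3) time_Suc[OF eps y, of x0 e n] step[OF n'] skel[of n] n(1) by simp
        moreover have "d n < x1 - x0" using d_less[of n] False n2 n' by simp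
        ultimately show False using X1 by simp
      qed
    qed
  qed
  ultimately have "hitting_time (\<lambda>t. fst (vjp U \<epsilon> x0 (-1) e t)) x1 = ennreal \<tau>"
    unfolding hitting_time_def using pos_\<tau>
    by (intro antisym Inf_lower Inf_greatest) (auto intro!: ennreal_leI)
  then show ?thesis by (simp add: \<tau>_def d_def H_def)
qed

end

section \<open>The standard exponential law\<close>

definition std_exponential :: "real measure" where
  "std_exponential = density lborel (exponential_density 1)"

interpretation std_exponential: real_distribution std_exponential
  unfolding real_distribution_def real_distribution_axioms_def std_exponential_def
  by (auto intro: prob_space_exponential_density)

lemma std_exponential_borel [simp, measurable_cong]: "sets std_exponential = sets borel"
  by simp

lemma distributed_std_exponential: "distributed std_exponential lborel (\<lambda>v. v) (exponential_density 1)"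
  unfolding distributed_def
proof (intro conjI)
  show "distr std_exponential lborel (\<lambda>v. v) = density lborel (exponential_density 1)"
    by (simp add: distr_id2 std_exponential_def)
qed (auto simp: std_exponential_def)

lemma AE_std_exponential_pos: "AE v in std_exponential. 0 < v"
proof -
  have "AE v in lborel. v \<noteq> (0::real)" by (rule AE_lborel_singleton)
  then show ?thesis
    unfolding std_exponential_def
    by (subst AE_density) (auto simp: exponential_density_def)
qed

lemma AE_std_exponential_neq: "AE v in std_exponential. v \<noteq> D"
proof -
  have "AE v in lborel. v \<noteq> D" by (rule AE_lborel_singleton)
  then show ?thesis
    unfolding std_exponential_def by (subst AE_density) auto
qed

lemma std_exponential_tail:
  assumes "0 \<le> D" shows "measure std_exponential {D..} = exp (- D)"
proof -
  have "measure std_exponential {D..} = measure std_exponential {D<..}"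
    using AE_std_exponential_neq[of D] by (intro measure_eq_AE) auto
  also have "{D<..} = {v \<in> space std_exponential. D < v}" by auto
  also have "measure std_exponential \<dots> = exp (- D * 1)"
    using std_exponential.exponential_distributedD_gt[OF distributed_std_exponential assms] by simp
  finally show ?thesis by simp
qed

lemma std_exponential_integrable_id: "integrable std_exponential (\<lambda>v. v)"
proof -
  have "integrable std_exponential (\<lambda>v. v ^ 1)"
    using std_exponential.erlang_ith_moment_integrable[OF _ distributed_std_exponential, of 1] by simp
  then show ?thesis by simp
qed

text \<open>
  The moment of order one half is \<open>\<Gamma>(3/2)\<close>.
\<close>

lemma std_exponential_sqrt: "has_bochner_integral std_exponential sqrt (sqrt pi / 2)"
proof (rule has_bochner_integral_nn_integral)
  have "(1/2 :: real) \<notin> \<int>\<^sub>\<le>\<^sub>0" using nonpos_Ints_nonpos[of "1/2 :: real"] by auto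
  then have g: "Gamma (3/2 :: real) = sqrt pi / 2"
    using Gamma_plus1[of "1/2 :: real"] Gamma_one_half_real by simp
  have "((\<lambda>t::real. t powr (1/2) / exp t) has_integral Gamma (3/2)) {0..}"
    using Gamma_integral_real[of "3/2"] by simp
  then have "((\<lambda>t::real. t powr (1/2) / exp t) has_integral (sqrt pi / 2)) {0..}"
    unfolding g .
  then have "((\<lambda>t::real. if t \<in> {0..} then t powr (1/2) / exp t else 0) has_integral (sqrt pi / 2)) UNIV"
    by (simp only: has_integral_restrict_UNIV)
  moreover have "(\<lambda>t::real. if t \<in> {0..} then t powr (1/2) / exp t else 0) =
      (\<lambda>t. indicator {0..} t * (t powr (1/2) / exp t))"
    by auto
  ultimately have "((\<lambda>t::real. indicator {0..} t * (t powr (1/2) / exp t)) has_integral (sqrt pi / 2)) UNIV"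
    by simp
  then have "(\<integral>\<^sup>+ t. ennreal (indicator {0..} t * (t powr (1/2) / exp t)) \<partial>lborel) = ennreal (sqrt pi / 2)"
    by (intro nn_integral_has_integral_lborel) auto
  moreover have "(\<integral>\<^sup>+ v. ennreal (sqrt v) \<partial>std_exponential) =
      (\<integral>\<^sup>+ t. ennreal (indicator {0..} t * (t powr (1/2) / exp t)) \<partial>lborel)"
    unfolding std_exponential_def
    by (subst nn_integral_density)
      (auto intro!: nn_integral_cong simp: exponential_density_def powr_half_sqrt exp_minus field_simps
        ennreal_mult'[symmetric] split: split_indicator)
  ultimately show "(\<integral>\<^sup>+ v. ennreal (sqrt v) \<partial>std_exponential) = ennreal (sqrt pi / 2)" by simp
qed (use AE_std_exponential_pos in auto)

text \<open>
  The integrand on the half-line is \<open>exp (c v)\<close> with \<open>c = \<i> s - 1\<close>, whose real part is negative, so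
  the integral is \<open>- 1 / c\<close>.
\<close>

lemma std_exponential_char: "char std_exponential s = 1 / (1 - \<i> * s)"
proof -
  define c where "c = \<i> * complex_of_real s - 1"
  have c: "c \<noteq> 0" by (auto simp: c_def complex_eq_iff)
  have "char std_exponential s = (LINT v|lborel. exponential_density 1 v *\<^sub>R iexp (s * v))"
    unfolding char_def std_exponential_def
    by (subst integral_density) (auto simp: exponential_density_def)
  also have "\<dots> = (LINT v|lborel. indicator {0<..} v *\<^sub>R exp (c * of_real v))"
  proof (rule integral_cong_AE)
    have "AE v in lborel. v \<noteq> (0::real)" by (rule AE_lborel_singleton)
    then show "AE v in lborel. exponential_density 1 v *\<^sub>R iexp (s * v) =
        indicator {0<..} v *\<^sub>R exp (c * of_real v)"
    proof eventually_elim
      case (elim v)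
      have "exp (c * of_real v) = of_real (exp (- v)) * iexp (s * v)"
        by (simp add: c_def algebra_simps exp_diff exp_minus exp_of_real[symmetric] field_simps)
      then show ?case using elim by (auto simp: exponential_density_def scaleR_conv_of_real)
    qed
  qed auto
  also have "\<dots> = (LBINT v=0..\<infinity>. exp (c * of_real v))"
    by (simp add: interval_lebesgue_integral_def set_lebesgue_integral_def einterval_def greaterThan_def)
  also have "\<dots> = 0 - 1 / c"
  proof (rule interval_integral_FTC_integrable[where F = "\<lambda>v. exp (c * of_real v) / c"])
    show "((\<lambda>v. exp (c * of_real v) / c) has_vector_derivative exp (c * of_real v)) (at v)" for v
    proof -
      have "((\<lambda>z. exp (c * z) / c) has_field_derivative exp (c * of_real v)) (at (of_real v))"
        using c by (auto intro!: derivative_eq_intros)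
      moreover have "(complex_of_real has_vector_derivative 1) (at v)"
        using has_vector_derivative_of_real[OF DERIV_ident[of "at v"]] by simp
      ultimately show ?thesis
        using field_vector_diff_chain_at[of complex_of_real 1 v "\<lambda>z. exp (c * z) / c" "exp (c * of_real v)"]
        by (simp add: o_def)
    qed
    show "isCont (\<lambda>v. exp (c * complex_of_real v)) v" for v by (intro continuous_intros)
    have "integrable lborel (\<lambda>v. exponential_density 1 v *\<^sub>R (1::real))"
      by (subst integrable_density[symmetric]) (auto simp: std_exponential_def[symmetric] exponential_density_nonneg)
    then have "integrable lborel (\<lambda>v. exponential_density 1 v)" by simp
    then show "set_integrable lborel (einterval 0 \<infinity>) (\<lambda>v. exp (c * complex_of_real v))"
      unfolding set_integrable_def
      by (rule Bochner_Integration.integrable_bound)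
        (auto simp: einterval_def c_def exponential_density_def split: split_indicator)
    show "(((\<lambda>v. exp (c * complex_of_real v) / c) \<circ> real_of_ereal) \<longlongrightarrow> 1 / c) (at_right 0)"
    proof -
      have "((\<lambda>v. exp (c * complex_of_real v) / c) \<longlongrightarrow> exp (c * of_real 0) / c) (at_right 0)"
        by (intro tendsto_intros c)
      then show ?thesis by (simp add: ereal_tendsto_simps zero_ereal_def del: ereal_eq_0)
    qed
    have "((\<lambda>v. exp (c * complex_of_real v) / c) \<longlongrightarrow> 0) at_top"
    proof (rule tendsto_norm_zero_cancel)
      have "((\<lambda>v::real. exp (- v) / norm c) \<longlongrightarrow> 0 / norm c) at_top"
        using c by (intro tendsto_intros filterlim_compose[OF exp_at_bot] filterlim_uminus_at_bot_at_top) auto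
      then show "((\<lambda>v. norm (exp (c * complex_of_real v) / c)) \<longlongrightarrow> 0) at_top"
        by (simp add: norm_divide c_def)
    qed
    then show "(((\<lambda>v. exp (c * complex_of_real v) / c) \<circ> real_of_ereal) \<longlongrightarrow> 0) (at_left \<infinity>)"
      by (simp add: ereal_tendsto_simps)
  qed simp
  finally show ?thesis using c by (simp add: c_def field_simps)
qed

section \<open>Geometric sums of independent cycles\<close>

lemma prod_pair_up: "(\<Prod>j<2 * m. h j) = (\<Prod>j<m. h (2 * j) * h (2 * j + 1))"
  for h :: "nat \<Rightarrow> 'b::comm_monoid_mult"
  by (induction m) (auto simp: mult.assoc)

lemma sum_pair_up: "(\<Sum>j<2 * m. h j) = (\<Sum>j<m. h (2 * j) + h (2 * j + 1))"
  for h :: "nat \<Rightarrow> 'b::comm_monoid_add"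
  by (induction m) (auto simp: add.assoc)

lemma emeasure_std_exponential_UNIV [simp]: "emeasure std_exponential UNIV = 1"
  using std_exponential.emeasure_space_1 by simp

lemma ennreal_affine: "0 \<le> a \<Longrightarrow> 0 \<le> s \<Longrightarrow> ennreal (a + 2 * s) = ennreal a + 2 * ennreal s"
  by (subst ennreal_plus, simp, simp, subst ennreal_mult, simp_all)

locale exponential_clocks =
  fixes M :: "'a measure" and E :: "nat \<Rightarrow> 'a \<Rightarrow> real"
  assumes iid: "iid_exponential M E"
begin

sublocale prob_space M
  using iid by (simp add: iid_exponential_def)

lemma indep: "indep_vars (\<lambda>_. borel) E UNIV"
  and clock_distributed: "distributed M lborel (E i) (exponential_density 1)"
  using iid by (auto simp: iid_exponential_def)

lemma clock_measurable [measurable]: "E i \<in> borel_measurable M"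
  using distributed_measurable[OF clock_distributed] by simp

lemma clock_distr: "distr M borel (E i) = std_exponential"
  using distributed_distr_eq_density[OF clock_distributed, of i]
  by (simp add: std_exponential_def cong: distr_cong)

lemma AE_clock: "AE v in std_exponential. P v \<Longrightarrow> AE \<omega> in M. P (E i \<omega>)"
  using AE_distrD[of "E i" M borel P, unfolded clock_distr] by simp

lemma nn_integral_clock: "f \<in> borel_measurable borel \<Longrightarrow> (\<integral>\<^sup>+\<omega>. f (E i \<omega>) \<partial>M) = (\<integral>\<^sup>+v. f v \<partial>std_exponential)"
  by (subst clock_distr[of i, symmetric], subst nn_integral_distr) auto

lemma integral_clock:
  fixes f :: "real \<Rightarrow> complex"
  shows "f \<in> borel_measurable borel \<Longrightarrow> (\<integral>\<omega>. f (E i \<omega>) \<partial>M) = (\<integral>v. f v \<partial>std_exponential)"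
  by (subst clock_distr[of i, symmetric], subst integral_distr) auto

lemma integrable_clock:
  fixes f :: "real \<Rightarrow> complex"
  assumes "integrable std_exponential f"
  shows "integrable M (\<lambda>\<omega>. f (E i \<omega>))"
  using assms by (subst (asm) clock_distr[of i, symmetric], subst (asm) integrable_distr_eq) auto

text \<open>
  A product statistic of the first \<open>m + 1\<close> cycles: \<open>f\<close> and \<open>g\<close> act on the even and odd clocks of the \<open>m\<close>
  completed cycles, \<open>F\<close> and \<open>G\<close> on those of the last one. The codomain is generic because the mean needs
  extended nonnegative values and the characteristic function complex ones.
\<close>

definition cycle_product :: "(real \<Rightarrow> 'b) \<Rightarrow> (real \<Rightarrow> 'b) \<Rightarrow> nat \<Rightarrow> (real \<Rightarrow> 'b) \<Rightarrow> (real \<Rightarrow> 'b) \<Rightarrow> 'a \<Rightarrow> 'b::comm_monoid_mult"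
  where "cycle_product f g m F G \<omega> =
    (\<Prod>j<m. f (E (2 * j) \<omega>) * g (E (2 * j + 1) \<omega>)) * (F (E (2 * m) \<omega>) * G (E (2 * m + 1) \<omega>))"

lemma cycle_product_eq_prod:
  "cycle_product f g m F G \<omega> = (\<Prod>j<2 * Suc m.
     (if j < 2 * m then if even j then f else g else if even j then F else G) (E j \<omega>))"
  unfolding prod_pair_up cycle_product_def by simp

lemma cycle_constant_prod:
  "(\<Prod>j<2 * Suc m. if j < 2 * m then if even j then a else b else if even j then c else d) =
     (a * b) ^ m * (c * d)" for a :: "'b::comm_monoid_mult"
  unfolding prod_pair_up by simp

lemma nn_integral_cycle_product:
  fixes f g F G :: "real \<Rightarrow> ennreal"
  assumes [measurable]: "f \<in> borel_measurable borel" "g \<in> borel_measurable borel"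
    "F \<in> borel_measurable borel" "G \<in> borel_measurable borel"
  shows "(\<integral>\<^sup>+\<omega>. cycle_product f g m F G \<omega> \<partial>M) =
    ((\<integral>\<^sup>+v. f v \<partial>std_exponential) * (\<integral>\<^sup>+v. g v \<partial>std_exponential)) ^ m *
    ((\<integral>\<^sup>+v. F v \<partial>std_exponential) * (\<integral>\<^sup>+v. G v \<partial>std_exponential))"
proof -
  define \<phi> where "\<phi> j = (if j < 2 * m then if even j then f else g else if even j then F else G)" for j
  have [measurable]: "\<phi> j \<in> borel_measurable borel" for j by (simp add: \<phi>_def)
  have "indep_vars (\<lambda>_. borel) (\<lambda>j \<omega>. \<phi> j (E j \<omega>)) {..<2 * Suc m}"
    by (rule indep_vars_compose2[OF indep_vars_subset[OF indep]]) auto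
  then have "(\<integral>\<^sup>+\<omega>. (\<Prod>j<2 * Suc m. \<phi> j (E j \<omega>)) \<partial>M) = (\<Prod>j<2 * Suc m. \<integral>\<^sup>+\<omega>. \<phi> j (E j \<omega>) \<partial>M)"
    by (rule indep_vars_nn_integral[rotated]) auto
  also have "\<dots> = (\<Prod>j<2 * Suc m. \<integral>\<^sup>+v. \<phi> j v \<partial>std_exponential)"
    by (simp only: nn_integral_clock[OF \<open>\<phi> _ \<in> _\<close>])
  also have "\<dots> = (\<Prod>j<2 * Suc m. if j < 2 * m
      then if even j then \<integral>\<^sup>+v. f v \<partial>std_exponential else \<integral>\<^sup>+v. g v \<partial>std_exponential
      else if even j then \<integral>\<^sup>+v. F v \<partial>std_exponential else \<integral>\<^sup>+v. G v \<partial>std_exponential)"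
    by (rule prod.cong) (auto simp: \<phi>_def)
  finally show ?thesis unfolding cycle_constant_prod cycle_product_eq_prod \<phi>_def .
qed

lemma
  fixes f g F G :: "real \<Rightarrow> complex"
  assumes int: "integrable std_exponential f" "integrable std_exponential g"
    "integrable std_exponential F" "integrable std_exponential G"
  shows integral_cycle_product: "(\<integral>\<omega>. cycle_product f g m F G \<omega> \<partial>M) =
      ((\<integral>v. f v \<partial>std_exponential) * (\<integral>v. g v \<partial>std_exponential)) ^ m *
      ((\<integral>v. F v \<partial>std_exponential) * (\<integral>v. G v \<partial>std_exponential))"
    and integrable_cycle_product: "integrable M (cycle_product f g m F G)"
proof -
  define \<phi> where "\<phi> j = (if j < 2 * m then if even j then f else g else if even j then F else G)" for j
  have \<phi>: "integrable std_exponential (\<phi> j)" for j using int by (simp add: \<phi>_def)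
  then have [measurable]: "\<phi> j \<in> borel_measurable borel" for j
    using borel_measurable_integrable[OF \<phi>[of j]] by simp
  have ind: "indep_vars (\<lambda>_. borel) (\<lambda>j \<omega>. \<phi> j (E j \<omega>)) {..<2 * Suc m}"
    by (rule indep_vars_compose2[OF indep_vars_subset[OF indep]]) auto
  have "(\<integral>\<omega>. (\<Prod>j<2 * Suc m. \<phi> j (E j \<omega>)) \<partial>M) = (\<Prod>j<2 * Suc m. \<integral>\<omega>. \<phi> j (E j \<omega>) \<partial>M)"
    by (rule indep_vars_lebesgue_integral[OF _ ind]) (auto intro: integrable_clock \<phi>)
  also have "\<dots> = (\<Prod>j<2 * Suc m. \<integral>v. \<phi> j v \<partial>std_exponential)"
    by (simp only: integral_clock[OF \<open>\<phi> _ \<in> _\<close>])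
  also have "\<dots> = (\<Prod>j<2 * Suc m. if j < 2 * m
      then if even j then \<integral>v. f v \<partial>std_exponential else \<integral>v. g v \<partial>std_exponential
      else if even j then \<integral>v. F v \<partial>std_exponential else \<integral>v. G v \<partial>std_exponential)"
    by (rule prod.cong) (auto simp: \<phi>_def)
  finally show "(\<integral>\<omega>. cycle_product f g m F G \<omega> \<partial>M) =
      ((\<integral>v. f v \<partial>std_exponential) * (\<integral>v. g v \<partial>std_exponential)) ^ m *
      ((\<integral>v. F v \<partial>std_exponential) * (\<integral>v. G v \<partial>std_exponential))"
    unfolding cycle_constant_prod cycle_product_eq_prod \<phi>_def .
  have "integrable M (\<lambda>\<omega>. \<Prod>j<2 * Suc m. \<phi> j (E j \<omega>))"
    by (rule indep_vars_integrable[OF _ ind]) (auto intro: integrable_clock \<phi>)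
  then show "integrable M (cycle_product f g m F G)"
    unfolding cycle_product_eq_prod[abs_def] \<phi>_def .
qed

end

text \<open>
  The abstract setting for a single temperature. A cycle fails when its odd clock is below \<open>D\<close>; the
  convention that \<open>r\<close> vanishes from \<open>D\<close> on lets the last cycle contribute the same summand as the failed
  ones. The formula for \<open>\<tau>\<close> is required only where the clocks are positive and avoid \<open>D\<close> up to the
  escape, which is the case almost surely.
\<close>

locale escape_cycles = exponential_clocks M E
  for M :: "'a measure" and E :: "nat \<Rightarrow> 'a \<Rightarrow> real" +
  fixes D H :: real and l r :: "real \<Rightarrow> real" and \<tau> :: "'a \<Rightarrow> ennreal"
  assumes D_pos: "0 < D" and H_pos: "0 < H"
    and l_integrable: "integrable std_exponential l" and r_integrable: "integrable std_exponential r"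
    and l_nonneg: "0 \<le> l v" and r_nonneg: "0 \<le> r v" and r_zero: "D \<le> v \<Longrightarrow> r v = 0"
    and \<tau>_measurable [measurable]: "\<tau> \<in> borel_measurable M"
    and \<tau>_eq: "(\<And>i. 0 < E i \<omega>) \<Longrightarrow> (\<And>j. j < k \<Longrightarrow> E (2 * j + 1) \<omega> < D) \<Longrightarrow> D < E (2 * k + 1) \<omega> \<Longrightarrow>
       \<tau> \<omega> = ennreal (H + 2 * (\<Sum>m<Suc k. l (E (2 * m) \<omega>) + r (E (2 * m + 1) \<omega>)))"
begin

lemma l_measurable [measurable]: "l \<in> borel_measurable borel"
  and r_measurable [measurable]: "r \<in> borel_measurable borel"
  using borel_measurable_integrable[OF l_integrable] borel_measurable_integrable[OF r_integrable] by auto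

text \<open>
  The probability that a single cycle escapes.
\<close>

definition p :: real where "p = exp (- D)"

lemma p_pos: "0 < p" and p_less_1: "p < 1"
  using D_pos by (auto simp: p_def)

lemma measure_escape: "measure std_exponential {D..} = p"
  using std_exponential_tail[of D] D_pos by (simp add: p_def)

lemma measure_return: "measure std_exponential {..<D} = 1 - p"
proof -
  have "{..<D} = space std_exponential - {D..}" by auto
  then show ?thesis
    using std_exponential.prob_compl[of "{D..}"] measure_escape by simp
qed

lemma nn_integral_return: "(\<integral>\<^sup>+v. indicator {..<D} v \<partial>std_exponential) = ennreal (1 - p)"
  by (simp add: measure_return std_exponential.emeasure_eq_measure)

definition escapes_at :: "'a \<Rightarrow> nat \<Rightarrow> bool" where
  "escapes_at \<omega> k \<longleftrightarrow> (\<forall>i. 0 < E i \<omega>) \<and> (\<forall>j<k. E (2 * j + 1) \<omega> < D) \<and> D < E (2 * k + 1) \<omega>"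

text \<open>
  The first \<open>m\<close> cycles all fail with probability \<open>(1 - p) ^ m\<close>, which tends to \<open>0\<close>.
\<close>

lemma AE_escapes: "AE \<omega> in M. \<exists>k. escapes_at \<omega> k"
proof -
  define N where "N = {\<omega> \<in> space M. \<forall>k. E (2 * k + 1) \<omega> < D}"
  have [measurable]: "N \<in> sets M" unfolding N_def by measurable
  have "emeasure M N \<le> ennreal ((1 - p) ^ m)" for m
  proof -
    let ?c = "cycle_product (\<lambda>_. 1) (indicator {..<D}) m (\<lambda>_. 1) (\<lambda>_. 1) :: 'a \<Rightarrow> ennreal"
    have "emeasure M N = (\<integral>\<^sup>+\<omega>. indicator N \<omega> \<partial>M)" by simp
    also have "\<dots> \<le> (\<integral>\<^sup>+\<omega>. ?c \<omega> \<partial>M)"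
      by (intro nn_integral_mono) (auto simp: N_def cycle_product_def split: split_indicator)
    also have "\<dots> = ennreal (1 - p) ^ m"
      by (subst nn_integral_cycle_product)
        (auto simp: nn_integral_return)
    finally show ?thesis using p_less_1 by (simp add: ennreal_power)
  qed
  moreover have "(\<lambda>m. ennreal ((1 - p) ^ m)) \<longlonglongrightarrow> ennreal 0"
    using p_pos p_less_1 by (intro tendsto_ennrealI LIMSEQ_power_zero) auto
  ultimately have "emeasure M N \<le> 0"
    using LIMSEQ_le_const[of "\<lambda>m. ennreal ((1 - p) ^ m)" 0 "emeasure M N"] by auto
  then have "AE \<omega> in M. \<not> (\<forall>k. E (2 * k + 1) \<omega> < D)"
    by (subst AE_iff_measurable[of N]) (auto simp: N_def)
  moreover have "AE \<omega> in M. \<forall>i. 0 < E i \<omega>"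
    by (intro AE_all_countable[THEN iffD2] allI AE_clock AE_std_exponential_pos)
  moreover have "AE \<omega> in M. \<forall>i. E i \<omega> \<noteq> D"
    by (intro AE_all_countable[THEN iffD2] allI AE_clock AE_std_exponential_neq)
  ultimately show ?thesis
  proof eventually_elim
    case (elim \<omega>)
    define k where "k = (LEAST k. \<not> E (2 * k + 1) \<omega> < D)"
    have "\<not> E (2 * k + 1) \<omega> < D"
      using LeastI_ex[of "\<lambda>k. \<not> E (2 * k + 1) \<omega> < D"] elim(1) unfolding k_def by blast
    then have "D < E (2 * k + 1) \<omega>"
      using elim(3)[rule_format, of "2 * k + 1"] by linarith
    moreover have "E (2 * j + 1) \<omega> < D" if "j < k" for j
      using not_less_Least[of j "\<lambda>k. \<not> E (2 * k + 1) \<omega> < D"] that unfolding k_def by blast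
    ultimately have "escapes_at \<omega> k"
      using elim(2) unfolding escapes_at_def by blast
    then show ?case by blast
  qed
qed

lemma \<tau>_escapes:
  "escapes_at \<omega> k \<Longrightarrow> \<tau> \<omega> = ennreal (H + 2 * (\<Sum>m<Suc k. l (E (2 * m) \<omega>) + r (E (2 * m + 1) \<omega>)))"
  by (rule \<tau>_eq) (auto simp: escapes_at_def)

definition mean :: real where
  "mean = H + 2 * ((\<integral>v. l v \<partial>std_exponential) + (\<integral>v. r v \<partial>std_exponential)) / p"

lemma mean_pos: "0 < mean"
proof -
  have "0 \<le> (\<integral>v. l v \<partial>std_exponential)" "0 \<le> (\<integral>v. r v \<partial>std_exponential)"
    using l_nonneg r_nonneg by (auto intro!: Bochner_Integration.integral_nonneg)
  then show ?thesis
    using H_pos p_pos unfolding mean_def by (simp add: add_pos_nonneg)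
qed

text \<open>
  The excursions of cycle \<open>m\<close> count when all earlier cycles have failed. That event is independent of the
  clocks of cycle \<open>m\<close>, so the cycle contributes \<open>(1 - p) ^ m\<close> times the mean excursion lengths, and
  the sum over \<open>m\<close> is a geometric series.
\<close>

lemma expectation_\<tau>: "(\<integral>\<^sup>+\<omega>. \<tau> \<omega> \<partial>M) = ennreal mean"
proof -
  define A where "A m = cycle_product (\<lambda>_. 1) (indicator {..<D}) m (\<lambda>v. ennreal (l v)) (\<lambda>_. 1)" for m
  define B where "B m = cycle_product (\<lambda>_. 1) (indicator {..<D}) m (\<lambda>_. 1) (\<lambda>v. ennreal (r v))" for m
  define a where "a = (\<integral>v. l v \<partial>std_exponential)"
  define b where "b = (\<integral>v. r v \<partial>std_exponential)"
  have ab: "0 \<le> a" "0 \<le> b" unfolding a_def b_def using l_nonneg r_nonneg by (auto intro!: integral_nonneg)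
  have [measurable]: "A m \<in> borel_measurable M" "B m \<in> borel_measurable M" for m
    unfolding A_def B_def cycle_product_def[abs_def] by measurable
  have int: "(\<integral>\<^sup>+\<omega>. A m \<omega> \<partial>M) + (\<integral>\<^sup>+\<omega>. B m \<omega> \<partial>M) = ennreal ((1 - p) ^ m * (a + b))" for m
  proof -
    have "(\<integral>\<^sup>+v. l v \<partial>std_exponential) = ennreal a" "(\<integral>\<^sup>+v. r v \<partial>std_exponential) = ennreal b"
      unfolding a_def b_def using l_integrable r_integrable l_nonneg r_nonneg
      by (auto intro!: nn_integral_eq_integral)
    then have "(\<integral>\<^sup>+\<omega>. A m \<omega> \<partial>M) = ennreal (1 - p) ^ m * ennreal a"
      "(\<integral>\<^sup>+\<omega>. B m \<omega> \<partial>M) = ennreal (1 - p) ^ m * ennreal b"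
      unfolding A_def B_def
      by (subst nn_integral_cycle_product;
          simp add: nn_integral_return)+
    then show ?thesis
      using ab p_less_1 by (simp add: ennreal_power ennreal_mult[symmetric] ennreal_plus[symmetric] distrib_left del: ennreal_plus)
  qed
  have "AE \<omega> in M. \<tau> \<omega> = ennreal H + 2 * (\<Sum>m. A m \<omega> + B m \<omega>)"
    using AE_escapes
  proof eventually_elim
    case (elim \<omega>)
    then obtain k where k: "escapes_at \<omega> k" by auto
    let ?s = "\<lambda>m. l (E (2 * m) \<omega>) + r (E (2 * m + 1) \<omega>)"
    have "A m \<omega> + B m \<omega> = 0" if "m \<notin> {..<Suc k}" for m
    proof -
      have "(\<Prod>j<m. 1 * indicator {..<D} (E (2 * j + 1) \<omega>) :: ennreal) = 0"
        using that k by (intro prod_zero) (auto intro!: bexI[of _ k] simp: escapes_at_def)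
      then show ?thesis unfolding A_def B_def cycle_product_def by simp
    qed
    moreover have "A m \<omega> + B m \<omega> = ennreal (?s m)" if "m \<in> {..<Suc k}" for m
    proof -
      have "(\<Prod>j<m. 1 * indicator {..<D} (E (2 * j + 1) \<omega>) :: ennreal) = 1"
        using that k by (intro prod.neutral) (auto simp: escapes_at_def)
      then show ?thesis unfolding A_def B_def cycle_product_def using l_nonneg r_nonneg by simp
    qed
    ultimately have "(\<Sum>m. A m \<omega> + B m \<omega>) = (\<Sum>m<Suc k. ennreal (?s m))"
      by (subst suminf_finite[of "{..<Suc k}"]) (auto simp del: sum.lessThan_Suc)
    also have "\<dots> = ennreal (\<Sum>m<Suc k. ?s m)"
      using l_nonneg r_nonneg by (intro sum_ennreal) simp
    finally show ?case
      using H_pos l_nonneg r_nonneg unfolding \<tau>_escapes[OF k]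
      by (subst ennreal_affine) (auto intro!: add_nonneg_nonneg sum_nonneg)
  qed
  then have "(\<integral>\<^sup>+\<omega>. \<tau> \<omega> \<partial>M) = (\<integral>\<^sup>+\<omega>. ennreal H + 2 * (\<Sum>m. A m \<omega> + B m \<omega>) \<partial>M)"
    by (rule nn_integral_cong_AE)
  also have "\<dots> = ennreal H + 2 * (\<Sum>m. (\<integral>\<^sup>+\<omega>. A m \<omega> \<partial>M) + (\<integral>\<^sup>+\<omega>. B m \<omega> \<partial>M))"
    by (simp add: nn_integral_add nn_integral_cmult nn_integral_suminf emeasure_space_1)
  also have "(\<Sum>m. (\<integral>\<^sup>+\<omega>. A m \<omega> \<partial>M) + (\<integral>\<^sup>+\<omega>. B m \<omega> \<partial>M)) = ennreal ((a + b) / p)"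
    unfolding int
  proof (rule suminf_ennreal_eq)
    show "(\<lambda>m. (1 - p) ^ m * (a + b)) sums ((a + b) / p)"
      using sums_mult2[OF geometric_sums[of "1 - p"], of "a + b"] p_pos p_less_1 by simp
  qed (use ab p_less_1 in auto)
  also have "ennreal H + 2 * ennreal ((a + b) / p) = ennreal mean"
    using H_pos ab p_pos ennreal_affine[of H "(a + b) / p"] by (simp add: mean_def a_def b_def)
  finally show ?thesis .
qed

definition \<alpha> :: "real \<Rightarrow> complex" where
  "\<alpha> \<theta> = (\<integral>v. iexp (2 * \<theta> * l v) \<partial>std_exponential)"

text \<open>
  The transform of a right excursion on the event that it fails. Since \<open>r\<close> vanishes on the
  complementary event, restricting the expectation amounts to subtracting \<open>p\<close>.
\<close>

definition \<beta> :: "real \<Rightarrow> complex" where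
  "\<beta> \<theta> = (\<integral>v. iexp (2 * \<theta> * r v) \<partial>std_exponential) - p"

text \<open>
  Splitting according to the cycle of escape, the exponential factorises over the clocks, which
  again gives a geometric series, now with ratio \<open>\<alpha> \<theta> * \<beta> \<theta>\<close>.
\<close>

lemma expectation_iexp_\<tau>:
  "(\<integral>\<omega>. iexp (\<theta> * enn2real (\<tau> \<omega>)) \<partial>M) = \<alpha> \<theta> * (p * iexp (\<theta> * H)) / (1 - \<alpha> \<theta> * \<beta> \<theta>)"
proof -
  define f where "f v = iexp (2 * \<theta> * l v)" for v
  define g where "g v = complex_of_real (indicator {..<D} v) * iexp (2 * \<theta> * r v)" for v
  define G where "G v = complex_of_real (indicator {D..} v) * iexp (\<theta> * H)" for v
  have [measurable]: "f \<in> borel_measurable borel" "g \<in> borel_measurable borel" "G \<in> borel_measurable borel"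
    unfolding f_def[abs_def] g_def[abs_def] G_def[abs_def] by measurable
  have norm1: "norm (f v) \<le> 1" "norm (g v) \<le> 1" "norm (G v) \<le> 1" for v
    by (auto simp: f_def g_def G_def norm_mult split: split_indicator)
  then have int: "integrable std_exponential f" "integrable std_exponential g" "integrable std_exponential G"
    by (auto intro!: std_exponential.integrable_const_bound[where B = 1])
  have int_f: "(\<integral>v. f v \<partial>std_exponential) = \<alpha> \<theta>"
    by (simp add: f_def \<alpha>_def)
  have int_G: "(\<integral>v. G v \<partial>std_exponential) = p * iexp (\<theta> * H)"
    using measure_escape by (simp add: G_def)
  have int_g: "(\<integral>v. g v \<partial>std_exponential) = \<beta> \<theta>"
  proof -
    have "g v = iexp (2 * \<theta> * r v) - complex_of_real (indicator {D..} v)" for v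
      using r_zero[of v] by (auto simp: g_def split: split_indicator)
    moreover have "integrable std_exponential (\<lambda>v. iexp (2 * \<theta> * r v))"
      by (auto intro!: std_exponential.integrable_const_bound[where B = 1])
    moreover have "integrable std_exponential (\<lambda>v. complex_of_real (indicator {D..} v))"
      by (auto intro!: std_exponential.integrable_const_bound[where B = 1] split: split_indicator)
    ultimately show ?thesis
      using measure_escape by (simp add: \<beta>_def)
  qed
  have norm_\<alpha>: "norm (\<alpha> \<theta>) \<le> 1"
    unfolding int_f[symmetric]
    by (rule order_trans[OF integral_norm_bound])
      (auto intro!: std_exponential.integral_le_const int norm1 integrable_norm)
  have norm_\<beta>: "norm (\<beta> \<theta>) \<le> 1 - p"
  proof -
    have "norm (\<beta> \<theta>) \<le> (\<integral>v. norm (g v) \<partial>std_exponential)"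
      unfolding int_g[symmetric] by (rule integral_norm_bound)
    also have "\<dots> = (\<integral>v. indicator {..<D} v \<partial>std_exponential)"
      by (rule Bochner_Integration.integral_cong) (auto simp: g_def norm_mult)
    finally show ?thesis using measure_return by simp
  qed
  have norm_\<alpha>\<beta>: "norm (\<alpha> \<theta> * \<beta> \<theta>) < 1"
    using mult_mono[OF norm_\<alpha> norm_\<beta>] p_pos by (simp add: norm_mult)
  let ?s = "\<lambda>n \<omega>. \<Sum>m<n. cycle_product f g m f G \<omega>"
  \<comment> \<open>Exactly one of the summands is nonzero, which makes the partial sums bounded by \<open>1\<close>.\<close>
  have at_k: "cycle_product f g m f G \<omega> = (if m = k then iexp (\<theta> * enn2real (\<tau> \<omega>)) else 0)"
    if k: "escapes_at \<omega> k" for m k \<omega>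
  proof -
    consider "m < k" | "m = k" | "k < m" by linarith
    then show ?thesis
    proof cases
      case 1
      then have "E (2 * m + 1) \<omega> < D" using k unfolding escapes_at_def by blast
      then have "G (E (2 * m + 1) \<omega>) = 0" by (simp add: G_def)
      then show ?thesis using 1 by (simp add: cycle_product_def)
    next
      case 3
      then have "(\<Prod>j<m. f (E (2 * j) \<omega>) * g (E (2 * j + 1) \<omega>)) = 0"
        using k by (intro prod_zero) (auto intro!: bexI[of _ k] simp: escapes_at_def g_def)
      then show ?thesis using 3 by (simp add: cycle_product_def)
    next
      case 2
      have "(\<Prod>j<k. f (E (2 * j) \<omega>) * g (E (2 * j + 1) \<omega>)) =
          (\<Prod>j<k. iexp (2 * \<theta> * (l (E (2 * j) \<omega>) + r (E (2 * j + 1) \<omega>))))"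
        using k by (intro prod.cong) (auto simp: f_def g_def escapes_at_def exp_add[symmetric] algebra_simps)
      also have "\<dots> = iexp (2 * \<theta> * (\<Sum>j<k. l (E (2 * j) \<omega>) + r (E (2 * j + 1) \<omega>)))"
        by (simp add: exp_sum[symmetric] sum_distrib_left)
      finally have *: "cycle_product f g k f G \<omega> =
          iexp (2 * \<theta> * (\<Sum>j<k. l (E (2 * j) \<omega>) + r (E (2 * j + 1) \<omega>))) *
          (iexp (2 * \<theta> * l (E (2 * k) \<omega>)) * iexp (\<theta> * H))"
        using k by (simp add: cycle_product_def f_def G_def escapes_at_def)
      have "r (E (2 * k + 1) \<omega>) = 0" using k by (intro r_zero) (simp add: escapes_at_def)
      then have "enn2real (\<tau> \<omega>) = H + 2 * ((\<Sum>j<k. l (E (2 * j) \<omega>) + r (E (2 * j + 1) \<omega>)) + l (E (2 * k) \<omega>))"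
        unfolding \<tau>_escapes[OF k] using H_pos l_nonneg r_nonneg
        by (subst enn2real_ennreal) (auto intro!: add_nonneg_nonneg sum_nonneg)
      then show ?thesis
        unfolding 2 * by (simp add: exp_add[symmetric] algebra_simps)
    qed
  qed
  have "(\<lambda>n. \<integral>\<omega>. ?s n \<omega> \<partial>M) \<longlonglongrightarrow> (\<integral>\<omega>. iexp (\<theta> * enn2real (\<tau> \<omega>)) \<partial>M)"
  proof (rule integral_dominated_convergence[where w = "\<lambda>_. 1"])
    show "AE \<omega> in M. (\<lambda>n. ?s n \<omega>) \<longlonglongrightarrow> iexp (\<theta> * enn2real (\<tau> \<omega>))"
      using AE_escapes
    proof eventually_elim
      case (elim \<omega>)
      then obtain k where k: "escapes_at \<omega> k" by auto
      show ?case
        using sums_single[of k "\<lambda>_. iexp (\<theta> * enn2real (\<tau> \<omega>))"] at_k[OF k] by (simp add: sums_def)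
    qed
    show "AE \<omega> in M. norm (?s n \<omega>) \<le> 1" for n
      using AE_escapes
    proof eventually_elim
      case (elim \<omega>)
      then obtain k where k: "escapes_at \<omega> k" by auto
      show ?case using at_k[OF k] by (simp add: sum.delta)
    qed
    show "?s n \<in> borel_measurable M" for n
      unfolding cycle_product_def by measurable
  qed auto
  moreover have "(\<integral>\<omega>. ?s n \<omega> \<partial>M) = (\<Sum>m<n. (\<alpha> \<theta> * \<beta> \<theta>) ^ m * (\<alpha> \<theta> * (p * iexp (\<theta> * H))))" for n
    using integral_cycle_product[OF int(1,2,1,3)] integrable_cycle_product[OF int(1,2,1,3)]
    by (simp add: int_f int_g int_G)
  ultimately have "(\<lambda>m. (\<alpha> \<theta> * \<beta> \<theta>) ^ m * (\<alpha> \<theta> * (p * iexp (\<theta> * H)))) sums (\<integral>\<omega>. iexp (\<theta> * enn2real (\<tau> \<omega>)) \<partial>M)"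
    by (simp add: sums_def)
  from sums_unique2[OF this sums_mult2[OF geometric_sums[OF norm_\<alpha>\<beta>], of "\<alpha> \<theta> * (p * iexp (\<theta> * H))"]]
  show ?thesis by simp
qed

end

section \<open>Excursions at low temperature\<close>

text \<open>
  A first-order expansion of characteristic functions along a vanishing scale \<open>p n\<close>. Dominated
  convergence applies because \<open>cmod (iexp z - 1) \<le> \<bar>z\<bar>\<close>.
\<close>

lemma (in prob_space) iexp_expectation_expansion:
  fixes g :: "nat \<Rightarrow> 'a \<Rightarrow> real"
  assumes g [measurable]: "\<And>n. g n \<in> borel_measurable M" and g' [measurable]: "g' \<in> borel_measurable M"
    and w: "integrable M w" "\<And>n. AE x in M. \<bar>g n x\<bar> \<le> w x"
    and lim: "AE x in M. (\<lambda>n. g n x) \<longlonglongrightarrow> g' x"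
    and q: "q \<longlonglongrightarrow> \<kappa>" and p: "p \<longlonglongrightarrow> 0" "\<And>n. 0 < p n"
  shows "(\<lambda>n. ((\<integral>x. iexp (q n * p n * g n x) \<partial>M) - 1) / p n) \<longlonglongrightarrow> \<i> * \<kappa> * (\<integral>x. g' x \<partial>M)"
proof -
  define h where "h n x = (iexp (q n * p n * g n x) - 1) / p n" for n x
  obtain K where K: "\<And>n. \<bar>q n\<bar> \<le> K" "0 < K"
    using convergent_imp_Bseq[OF convergentI[OF q]] by (auto simp: Bseq_def)
  have "(\<lambda>n. \<integral>x. h n x \<partial>M) \<longlonglongrightarrow> (\<integral>x. \<i> * \<kappa> * complex_of_real (g' x) \<partial>M)"
  proof (rule integral_dominated_convergence[where w = "\<lambda>x. K * w x"])
    show "AE x in M. norm (h n x) \<le> K * w x" for n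
      using w(2)[of n]
    proof eventually_elim
      case (elim x)
      have "norm (iexp (q n * p n * g n x) - 1) \<le> \<bar>q n * p n * g n x\<bar>"
        using iexp_approx1[of "q n * p n * g n x" 0] by simp
      then have "norm (h n x) \<le> \<bar>q n\<bar> * \<bar>g n x\<bar>"
        using p(2)[of n] by (simp add: h_def norm_divide abs_mult field_simps)
      also have "\<dots> \<le> K * w x" using K elim by (intro mult_mono) (auto intro: order_trans[OF abs_ge_zero])
      finally show ?case .
    qed
    show "AE x in M. (\<lambda>n. h n x) \<longlonglongrightarrow> \<i> * \<kappa> * complex_of_real (g' x)"
      using lim
    proof eventually_elim
      case (elim x)
      have "(\<lambda>n. h n x - \<i> * q n * g n x) \<longlonglongrightarrow> 0"
      proof (rule Lim_null_comparison)
        show "(\<lambda>n. (q n * g n x)\<^sup>2 / 2 * p n) \<longlonglongrightarrow> 0"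
          by (rule tendsto_eq_intros q elim p(1) refl | simp)+
        show "\<forall>\<^sub>F n in sequentially. norm (h n x - \<i> * q n * g n x) \<le> (q n * g n x)\<^sup>2 / 2 * p n"
        proof (rule always_eventually, rule allI)
          fix n
          define z where "z = q n * p n * g n x"
          have "norm (iexp z - (1 + \<i> * z)) \<le> z\<^sup>2 / 2"
            using iexp_approx1[of z 1] by (simp add: power2_eq_square numeral_2_eq_2)
          then have "norm (iexp z - (1 + \<i> * z)) / p n \<le> z\<^sup>2 / 2 / p n"
            by (rule divide_right_mono) (use p(2)[of n] in simp)
          moreover have "h n x - \<i> * q n * g n x = (iexp z - (1 + \<i> * z)) / p n"
            using p(2)[of n] by (simp add: h_def z_def field_simps)
          ultimately have "norm (h n x - \<i> * q n * g n x) \<le> z\<^sup>2 / 2 / p n"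
            using p(2)[of n] by (simp only: norm_divide norm_of_real abs_of_pos)
          also have "z\<^sup>2 / 2 / p n = (q n * g n x)\<^sup>2 / 2 * p n"
            using p(2)[of n] by (simp add: z_def power2_eq_square field_simps)
          finally show "norm (h n x - \<i> * q n * g n x) \<le> (q n * g n x)\<^sup>2 / 2 * p n" .
        qed
      qed
      moreover have "(\<lambda>n. \<i> * q n * g n x) \<longlonglongrightarrow> \<i> * \<kappa> * complex_of_real (g' x)"
        by (intro tendsto_intros q elim)
      ultimately have "(\<lambda>n. h n x - \<i> * q n * g n x + \<i> * q n * g n x) \<longlonglongrightarrow> 0 + \<i> * \<kappa> * complex_of_real (g' x)"
        by (rule tendsto_add)
      then show ?case by simp
    qed
    show "h n \<in> borel_measurable M" for n unfolding h_def by measurable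
    show "integrable M (\<lambda>x. K * w x)" using w(1) by simp
  qed measurable
  moreover have "(\<integral>x. h n x \<partial>M) = ((\<integral>x. iexp (q n * p n * g n x) \<partial>M) - 1) / p n" for n
  proof -
    have "integrable M (\<lambda>x. iexp (q n * p n * g n x))"
      by (auto intro!: integrable_const_bound[where B = 1])
    then show ?thesis unfolding h_def by (simp add: prob_space)
  qed
  ultimately show ?thesis by simp
qed

lemma sqrt_8_pi: "sqrt (8 * pi / c) = 4 * (sqrt (2 / c) * (sqrt pi / 2))"
proof -
  have "sqrt (8 * pi / c) = sqrt (2\<^sup>2 * (2 / c) * pi)" by (simp add: field_simps)
  also have "\<dots> = 2 * sqrt (2 / c) * sqrt pi"
    unfolding real_sqrt_mult by simp
  finally show ?thesis by simp
qed

context double_well_potential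
begin

definition left_excursion :: "real \<Rightarrow> real \<Rightarrow> real" where
  "left_excursion \<epsilon> v = reach U x0 (-1) (\<epsilon> * v)"

text \<open>
  The value \<open>0\<close> for clocks beyond the barrier height reflects that the final climb, which has the fixed length
  \<open>x1 - x0\<close>, is not an excursion.
\<close>

definition right_excursion :: "real \<Rightarrow> real \<Rightarrow> real" where
  "right_excursion \<epsilon> v = (if v < (U x1 - U x0) / \<epsilon> then reach U x0 1 (\<epsilon> * v) else 0)"

lemma excursion_nonneg: "0 \<le> left_excursion \<epsilon> v" "0 \<le> right_excursion \<epsilon> v"
  by (auto simp: left_excursion_def right_excursion_def reach_nonneg)

lemma excursion_measurable [measurable]:
  "left_excursion \<epsilon> \<in> borel_measurable borel" "right_excursion \<epsilon> \<in> borel_measurable borel"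
proof -
  have [measurable]: "(\<lambda>v. reach U x0 (-1) (\<epsilon> * v)) \<in> borel_measurable borel"
    "(\<lambda>v. reach U x0 1 (\<epsilon> * v)) \<in> borel_measurable borel"
    by (auto intro!: reach_measurable)
  show "left_excursion \<epsilon> \<in> borel_measurable borel" "right_excursion \<epsilon> \<in> borel_measurable borel"
    unfolding left_excursion_def[abs_def] right_excursion_def[abs_def] by measurable
qed

text \<open>
  The common factor \<open>sqrt \<epsilon>\<close> is split off so that, for bounded \<open>\<epsilon>\<close>, what remains is an integrable
  majorant of the rescaled excursions.
\<close>

lemma excursion_bound:
  obtains C where "0 \<le> C"
    "\<And>\<epsilon> v. 0 < \<epsilon> \<Longrightarrow> 0 < v \<Longrightarrow> left_excursion \<epsilon> v \<le> sqrt \<epsilon> * (C * (sqrt v + sqrt \<epsilon> * v))"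
    "\<And>\<epsilon> v. 0 < \<epsilon> \<Longrightarrow> 0 < v \<Longrightarrow> right_excursion \<epsilon> v \<le> sqrt \<epsilon> * (C * (sqrt v + sqrt \<epsilon> * v))"
proof -
  obtain A where A: "A \<ge> 0" "\<And>u. 0 < u \<Longrightarrow> reach U x0 (-1) u \<le> A * (sqrt u + u)"
    using reach_left_bound by auto
  obtain B where B: "B \<ge> 0" "\<And>u. 0 < u \<Longrightarrow> u < U x1 - U x0 \<Longrightarrow> reach U x0 1 u \<le> B * (sqrt u + u)"
    using reach_right_bound by auto
  let ?C = "max A B"
  have scale: "max A B * (sqrt (\<epsilon> * v) + \<epsilon> * v) = sqrt \<epsilon> * (?C * (sqrt v + sqrt \<epsilon> * v))"
    if "0 < \<epsilon>" for \<epsilon> v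
  proof -
    have "\<epsilon> = sqrt \<epsilon> * sqrt \<epsilon>" using that by simp
    then have "sqrt (\<epsilon> * v) + \<epsilon> * v = sqrt \<epsilon> * (sqrt v + sqrt \<epsilon> * v)"
      by (metis distrib_left mult.assoc real_sqrt_mult)
    then show ?thesis by simp
  qed
  show thesis
  proof (rule that)
    show "0 \<le> ?C" using A(1) by simp
    fix \<epsilon> v :: real assume pos: "0 < \<epsilon>" "0 < v"
    have le: "K * (sqrt (\<epsilon> * v) + \<epsilon> * v) \<le> ?C * (sqrt (\<epsilon> * v) + \<epsilon> * v)" if "K \<le> ?C" for K
      using pos that by (intro mult_right_mono) auto
    show "left_excursion \<epsilon> v \<le> sqrt \<epsilon> * (?C * (sqrt v + sqrt \<epsilon> * v))"
      using A(2)[of "\<epsilon> * v"] le[of A] pos unfolding left_excursion_def scale[OF pos(1), symmetric] by force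
    have "0 \<le> ?C * (sqrt (\<epsilon> * v) + \<epsilon> * v)" using A(1) pos by (intro mult_nonneg_nonneg) auto
    then show "right_excursion \<epsilon> v \<le> sqrt \<epsilon> * (?C * (sqrt v + sqrt \<epsilon> * v))"
      using B(2)[of "\<epsilon> * v"] le[of B] pos
      unfolding right_excursion_def scale[OF pos(1), symmetric] by (auto simp: field_simps)
  qed
qed

lemma excursion_integrable:
  assumes "0 < \<epsilon>"
  shows "integrable std_exponential (left_excursion \<epsilon>)" "integrable std_exponential (right_excursion \<epsilon>)"
proof -
  obtain C where C: "0 \<le> C"
    "\<And>\<epsilon> v. 0 < \<epsilon> \<Longrightarrow> 0 < v \<Longrightarrow> left_excursion \<epsilon> v \<le> sqrt \<epsilon> * (C * (sqrt v + sqrt \<epsilon> * v))"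
    "\<And>\<epsilon> v. 0 < \<epsilon> \<Longrightarrow> 0 < v \<Longrightarrow> right_excursion \<epsilon> v \<le> sqrt \<epsilon> * (C * (sqrt v + sqrt \<epsilon> * v))"
    using excursion_bound by metis
  have w: "integrable std_exponential (\<lambda>v. sqrt \<epsilon> * (C * (sqrt v + sqrt \<epsilon> * v)))"
    using std_exponential_sqrt std_exponential_integrable_id by (auto simp: has_bochner_integral_iff)
  have "AE v in std_exponential. norm (left_excursion \<epsilon> v) \<le> norm (sqrt \<epsilon> * (C * (sqrt v + sqrt \<epsilon> * v)))"
    using AE_std_exponential_pos
    by eventually_elim (use C(2)[OF assms] excursion_nonneg in \<open>auto intro: order_trans[OF _ abs_ge_self]\<close>)
  then show "integrable std_exponential (left_excursion \<epsilon>)"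
    by (intro Bochner_Integration.integrable_bound[OF w]) auto
  have "AE v in std_exponential. norm (right_excursion \<epsilon> v) \<le> norm (sqrt \<epsilon> * (C * (sqrt v + sqrt \<epsilon> * v)))"
    using AE_std_exponential_pos
    by eventually_elim (use C(3)[OF assms] excursion_nonneg in \<open>auto intro: order_trans[OF _ abs_ge_self]\<close>)
  then show "integrable std_exponential (right_excursion \<epsilon>)"
    by (intro Bochner_Integration.integrable_bound[OF w]) auto
qed

lemma
  assumes X: "\<And>n. 0 < X n" "X \<longlonglongrightarrow> 0" and v: "0 < v"
  shows left_excursion_limit:
      "(\<lambda>n. left_excursion (X n) v / sqrt (X n)) \<longlonglongrightarrow> sqrt (2 / deriv (deriv U) x0) * sqrt v"
    and right_excursion_limit:
      "(\<lambda>n. right_excursion (X n) v / sqrt (X n)) \<longlonglongrightarrow> sqrt (2 / deriv (deriv U) x0) * sqrt v"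
proof -
  have Xv: "(\<lambda>n. X n * v) \<longlonglongrightarrow> 0" using tendsto_mult_right[OF X(2), of v] by simp
  have lim: "(\<lambda>n. reach U x0 y (X n * v) / sqrt (X n)) \<longlonglongrightarrow> sqrt (2 / deriv (deriv U) x0) * sqrt v"
    if y: "y = 1 \<or> y = -1" for y
  proof -
    have "X n * v \<in> {0<..} \<and> X n * v \<noteq> 0" for n using X(1)[of n] v by simp
    then have "filterlim (\<lambda>n. X n * v) (at_right 0) sequentially"
      using Xv by (simp add: filterlim_at)
    from filterlim_compose[OF reach_asymptotics[OF y _ climb_quadratic[OF y]] this]
    have "(\<lambda>n. reach U x0 y (X n * v) / sqrt (X n * v) * sqrt v) \<longlonglongrightarrow>
        1 / sqrt (deriv (deriv U) x0 / 2) * sqrt v"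
      using curvature_pos by (intro tendsto_mult tendsto_const) simp
    then show ?thesis
      using v X(1) by (simp add: real_sqrt_mult real_sqrt_divide field_simps)
  qed
  show "(\<lambda>n. left_excursion (X n) v / sqrt (X n)) \<longlonglongrightarrow> sqrt (2 / deriv (deriv U) x0) * sqrt v"
    using lim[of "-1"] by (simp add: left_excursion_def)
  have "\<forall>\<^sub>F n in sequentially. X n * v < U x1 - U x0"
    using order_tendstoD(2)[OF Xv, of "U x1 - U x0"] barrier_pos by simp
  then have "\<forall>\<^sub>F n in sequentially. reach U x0 1 (X n * v) / sqrt (X n) = right_excursion (X n) v / sqrt (X n)"
    by eventually_elim (use X(1) in \<open>simp add: right_excursion_def field_simps\<close>)
  then show "(\<lambda>n. right_excursion (X n) v / sqrt (X n)) \<longlonglongrightarrow> sqrt (2 / deriv (deriv U) x0) * sqrt v"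
    by (rule Lim_transform_eventually[OF lim[of 1, simplified]])
qed

text \<open>
  The ascents are grouped in pairs. The escaping cycle has no right excursion, in accordance with the value
  \<open>0\<close> of \<open>right_excursion\<close> at its odd clock.
\<close>

lemma escape_cycles_well:
  assumes eps: "0 < \<epsilon>" and iid: "iid_exponential M E"
  shows "escape_cycles M E ((U x1 - U x0) / \<epsilon>) (x1 - x0) (left_excursion \<epsilon>) (right_excursion \<epsilon>)
    (\<lambda>\<omega>. hitting_time (\<lambda>t. fst (vjp U \<epsilon> x0 (-1) (\<lambda>i. E i \<omega>) t)) x1)"
proof -
  interpret exponential_clocks M E by standard (rule iid)
  show ?thesis
  proof
    show "0 < (U x1 - U x0) / \<epsilon>" "0 < x1 - x0" using barrier_pos eps x01 by auto
    show "(\<lambda>\<omega>. hitting_time (\<lambda>t. fst (vjp U \<epsilon> x0 (-1) (\<lambda>i. E i \<omega>) t)) x1) \<in> borel_measurable M"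
      using eps by (intro hitting_time_measurable) auto
    fix \<omega> k
    assume pos: "\<And>i. 0 < E i \<omega>" and low: "\<And>j. j < k \<Longrightarrow> E (2 * j + 1) \<omega> < (U x1 - U x0) / \<epsilon>"
      and high: "(U x1 - U x0) / \<epsilon> < E (2 * k + 1) \<omega>"
    have "(\<Sum>j<2 * k + 1. ascent \<epsilon> (\<lambda>i. E i \<omega>) j) =
        (\<Sum>m<k. ascent \<epsilon> (\<lambda>i. E i \<omega>) (2 * m) + ascent \<epsilon> (\<lambda>i. E i \<omega>) (2 * m + 1)) + ascent \<epsilon> (\<lambda>i. E i \<omega>) (2 * k)"
      by (simp add: sum_pair_up)
    also have "(\<Sum>m<k. ascent \<epsilon> (\<lambda>i. E i \<omega>) (2 * m) + ascent \<epsilon> (\<lambda>i. E i \<omega>) (2 * m + 1)) =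
        (\<Sum>m<k. left_excursion \<epsilon> (E (2 * m) \<omega>) + right_excursion \<epsilon> (E (2 * m + 1) \<omega>))"
      using low by (intro sum.cong) (auto simp: ascent_def left_excursion_def right_excursion_def)
    also have "\<dots> + ascent \<epsilon> (\<lambda>i. E i \<omega>) (2 * k) =
        (\<Sum>m<Suc k. left_excursion \<epsilon> (E (2 * m) \<omega>) + right_excursion \<epsilon> (E (2 * m + 1) \<omega>))"
      using high by (simp add: ascent_def left_excursion_def right_excursion_def)
    finally show "hitting_time (\<lambda>t. fst (vjp U \<epsilon> x0 (-1) (\<lambda>i. E i \<omega>) t)) x1 = ennreal (x1 - x0 +
        2 * (\<Sum>m<Suc k. left_excursion \<epsilon> (E (2 * m) \<omega>) + right_excursion \<epsilon> (E (2 * m + 1) \<omega>)))"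
      using hitting_time_well[OF eps, of "\<lambda>i. E i \<omega>" k] pos low high eps by (simp add: field_simps)
  qed (use eps excursion_integrable excursion_nonneg in \<open>auto simp: right_excursion_def\<close>)
qed

section \<open>Limits along a sequence of temperatures\<close>

context
  fixes M :: "nat \<Rightarrow> 'a measure" and E :: "nat \<Rightarrow> nat \<Rightarrow> 'a \<Rightarrow> real" and X :: "nat \<Rightarrow> real"
    and \<tau> :: "nat \<Rightarrow> 'a \<Rightarrow> ennreal"
  assumes X_pos: "\<And>n. 0 < X n" and X_lim: "X \<longlonglongrightarrow> 0"
    and cycles: "\<And>n. escape_cycles (M n) (E n) ((U x1 - U x0) / X n) (x1 - x0)
      (left_excursion (X n)) (right_excursion (X n)) (\<tau> n)"
begin

abbreviation (input) curvature :: real where "curvature \<equiv> deriv (deriv U) x0"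

definition escape_prob :: "nat \<Rightarrow> real" where "escape_prob n = exp (- ((U x1 - U x0) / X n))"

definition mean_time :: "nat \<Rightarrow> real" where "mean_time n = enn2real (\<integral>\<^sup>+\<omega>. \<tau> n \<omega> \<partial>M n)"

lemma mean_time_pos: "0 < mean_time n"
  and nn_integral_time: "(\<integral>\<^sup>+\<omega>. \<tau> n \<omega> \<partial>M n) = ennreal (mean_time n)"
  and mean_time_eq: "mean_time n = x1 - x0 + 2 * ((\<integral>v. left_excursion (X n) v \<partial>std_exponential) +
    (\<integral>v. right_excursion (X n) v \<partial>std_exponential)) / escape_prob n"
  using escape_cycles.expectation_\<tau>[OF cycles, of n] escape_cycles.mean_pos[OF cycles, of n]
    escape_cycles.mean_def[OF cycles, of n] escape_cycles.p_def[OF cycles, of n]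
  by (auto simp: mean_time_def escape_prob_def)

lemma escape_prob_pos: "0 < escape_prob n"
  by (simp add: escape_prob_def)

lemma sqrt_X_lim: "(\<lambda>n. sqrt (X n)) \<longlonglongrightarrow> 0"
  using tendsto_real_sqrt[OF X_lim] by simp

text \<open>
  Thus the final climb of length \<open>x1 - x0\<close> does not contribute to the leading order of the mean, which is
  \<open>sqrt \<epsilon> / p\<close>. The bound \<open>exp (- z) \<le> 1 / z\<close> is enough.
\<close>

lemma escape_prob_negligible: "(\<lambda>n. escape_prob n / sqrt (X n)) \<longlonglongrightarrow> 0"
proof (rule Lim_null_comparison)
  let ?\<Delta> = "U x1 - U x0"
  show "(\<lambda>n. sqrt (X n) / ?\<Delta>) \<longlonglongrightarrow> 0"
    using tendsto_divide[OF sqrt_X_lim tendsto_const[of ?\<Delta>]] barrier_pos by simp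
  show "\<forall>\<^sub>F n in sequentially. norm (escape_prob n / sqrt (X n)) \<le> sqrt (X n) / ?\<Delta>"
  proof (rule always_eventually, rule allI)
    fix n
    have "?\<Delta> / X n \<le> exp (?\<Delta> / X n)" using exp_ge_add_one_self[of "?\<Delta> / X n"] by linarith
    then have "escape_prob n \<le> X n / ?\<Delta>"
      using X_pos[of n] barrier_pos by (simp add: escape_prob_def exp_minus field_simps)
    then have "escape_prob n / sqrt (X n) \<le> X n / ?\<Delta> / sqrt (X n)"
      using X_pos[of n] by (intro divide_right_mono) auto
    also have "\<dots> = X n / sqrt (X n) / ?\<Delta>" by simp
    also have "\<dots> = sqrt (X n) / ?\<Delta>" using X_pos[of n] by (simp add: real_div_sqrt)
    finally show "norm (escape_prob n / sqrt (X n)) \<le> sqrt (X n) / ?\<Delta>"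
      using X_pos[of n] escape_prob_pos[of n] by simp
  qed
qed

lemma escape_prob_lim: "escape_prob \<longlonglongrightarrow> 0"
proof -
  have "(\<lambda>n. escape_prob n / sqrt (X n) * sqrt (X n)) \<longlonglongrightarrow> 0 * 0"
    by (intro tendsto_mult escape_prob_negligible sqrt_X_lim)
  then show ?thesis using X_pos by (simp add: less_imp_neq[THEN not_sym])
qed

lemma excursion_dominated:
  obtains w where "integrable std_exponential w"
    "\<And>n. AE v in std_exponential. \<bar>left_excursion (X n) v / sqrt (X n)\<bar> \<le> w v"
    "\<And>n. AE v in std_exponential. \<bar>right_excursion (X n) v / sqrt (X n)\<bar> \<le> w v"
proof -
  obtain C where C: "0 \<le> C"
    "\<And>\<epsilon> v. 0 < \<epsilon> \<Longrightarrow> 0 < v \<Longrightarrow> left_excursion \<epsilon> v \<le> sqrt \<epsilon> * (C * (sqrt v + sqrt \<epsilon> * v))"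
    "\<And>\<epsilon> v. 0 < \<epsilon> \<Longrightarrow> 0 < v \<Longrightarrow> right_excursion \<epsilon> v \<le> sqrt \<epsilon> * (C * (sqrt v + sqrt \<epsilon> * v))"
    using excursion_bound by metis
  obtain K where K: "\<And>n. norm (sqrt (X n)) \<le> K"
    using convergent_imp_Bseq[OF convergentI[OF sqrt_X_lim]] by (auto simp: Bseq_def)
  have bound: "\<bar>f / sqrt (X n)\<bar> \<le> C * (sqrt v + K * v)"
    if "0 < v" "0 \<le> f" "f \<le> sqrt (X n) * (C * (sqrt v + sqrt (X n) * v))" for f v n
  proof -
    have "\<bar>f / sqrt (X n)\<bar> \<le> C * (sqrt v + sqrt (X n) * v)"
      using that X_pos[of n] by (simp add: field_simps)
    also have "\<dots> \<le> C * (sqrt v + K * v)"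
      using K[of n] that(1) C(1) X_pos[of n] by (intro mult_left_mono add_left_mono mult_right_mono) auto
    finally show ?thesis .
  qed
  show thesis
  proof (rule that)
    show "integrable std_exponential (\<lambda>v. C * (sqrt v + K * v))"
      using std_exponential_sqrt std_exponential_integrable_id by (auto simp: has_bochner_integral_iff)
    show "AE v in std_exponential. \<bar>left_excursion (X n) v / sqrt (X n)\<bar> \<le> C * (sqrt v + K * v)" for n
      using AE_std_exponential_pos
      by eventually_elim (rule bound, assumption, rule excursion_nonneg, rule C(2)[OF X_pos])
    show "AE v in std_exponential. \<bar>right_excursion (X n) v / sqrt (X n)\<bar> \<le> C * (sqrt v + K * v)" for n
      using AE_std_exponential_pos
      by eventually_elim (rule bound, assumption, rule excursion_nonneg, rule C(3)[OF X_pos])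
  qed
qed

lemma excursion_limits_AE:
  "AE v in std_exponential. (\<lambda>n. left_excursion (X n) v / sqrt (X n)) \<longlonglongrightarrow> sqrt (2 / curvature) * sqrt v"
  "AE v in std_exponential. (\<lambda>n. right_excursion (X n) v / sqrt (X n)) \<longlonglongrightarrow> sqrt (2 / curvature) * sqrt v"
  using AE_std_exponential_pos
  by (eventually_elim, use left_excursion_limit right_excursion_limit X_pos X_lim in blast)+

lemma integral_limit_excursion:
  "(\<integral>v. sqrt (2 / curvature) * sqrt v \<partial>std_exponential) = sqrt (2 / curvature) * (sqrt pi / 2)"
  using std_exponential_sqrt by (simp add: has_bochner_integral_iff)

lemma mean_excursion_limits:
  "(\<lambda>n. (\<integral>v. left_excursion (X n) v \<partial>std_exponential) / sqrt (X n)) \<longlonglongrightarrow> sqrt (2 / curvature) * (sqrt pi / 2)"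
  "(\<lambda>n. (\<integral>v. right_excursion (X n) v \<partial>std_exponential) / sqrt (X n)) \<longlonglongrightarrow> sqrt (2 / curvature) * (sqrt pi / 2)"
proof -
  obtain w where w: "integrable std_exponential w"
    "\<And>n. AE v in std_exponential. \<bar>left_excursion (X n) v / sqrt (X n)\<bar> \<le> w v"
    "\<And>n. AE v in std_exponential. \<bar>right_excursion (X n) v / sqrt (X n)\<bar> \<le> w v"
    using excursion_dominated by metis
  have "(\<lambda>n. \<integral>v. left_excursion (X n) v / sqrt (X n) \<partial>std_exponential) \<longlonglongrightarrow>
      (\<integral>v. sqrt (2 / curvature) * sqrt v \<partial>std_exponential)"
    using w excursion_limits_AE(1) by (intro integral_dominated_convergence[where w = w]) auto
  then show "(\<lambda>n. (\<integral>v. left_excursion (X n) v \<partial>std_exponential) / sqrt (X n)) \<longlonglongrightarrow> sqrt (2 / curvature) * (sqrt pi / 2)"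
    unfolding integral_limit_excursion by simp
  have "(\<lambda>n. \<integral>v. right_excursion (X n) v / sqrt (X n) \<partial>std_exponential) \<longlonglongrightarrow>
      (\<integral>v. sqrt (2 / curvature) * sqrt v \<partial>std_exponential)"
    using w excursion_limits_AE(2) by (intro integral_dominated_convergence[where w = w]) auto
  then show "(\<lambda>n. (\<integral>v. right_excursion (X n) v \<partial>std_exponential) / sqrt (X n)) \<longlonglongrightarrow> sqrt (2 / curvature) * (sqrt pi / 2)"
    unfolding integral_limit_excursion by simp
qed

text \<open>
  Left and right excursions contribute equally, each being travelled twice: hence four times
  the limit in \<open>mean_excursion_limits\<close>, which \<open>sqrt_8_pi\<close> puts into the form of the Eyring-Kramers prefactor.
\<close>

lemma mean_time_asymptotics:
  "(\<lambda>n. mean_time n * escape_prob n / sqrt (X n)) \<longlonglongrightarrow> sqrt (8 * pi / curvature)"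
proof -
  let ?c = "sqrt (2 / curvature) * (sqrt pi / 2)"
  have "(\<lambda>n. (x1 - x0) * (escape_prob n / sqrt (X n)) +
      2 * ((\<integral>v. left_excursion (X n) v \<partial>std_exponential) / sqrt (X n) +
        (\<integral>v. right_excursion (X n) v \<partial>std_exponential) / sqrt (X n))) \<longlonglongrightarrow> (x1 - x0) * 0 + 2 * (?c + ?c)"
    by (intro tendsto_intros escape_prob_negligible mean_excursion_limits)
  moreover have "(x1 - x0) * (escape_prob n / sqrt (X n)) +
      2 * ((\<integral>v. left_excursion (X n) v \<partial>std_exponential) / sqrt (X n) +
        (\<integral>v. right_excursion (X n) v \<partial>std_exponential) / sqrt (X n)) = mean_time n * escape_prob n / sqrt (X n)" for n
  proof -
    have "mean_time n * escape_prob n = (x1 - x0) * escape_prob n +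
        2 * ((\<integral>v. left_excursion (X n) v \<partial>std_exponential) + (\<integral>v. right_excursion (X n) v \<partial>std_exponential))"
      unfolding mean_time_eq[of n] using escape_prob_pos[of n] by (simp add: field_simps)
    then show ?thesis by (simp only: add_divide_distrib distrib_left times_divide_eq_right)
  qed
  ultimately show ?thesis unfolding sqrt_8_pi by simp
qed

lemma mean_time_equivalent:
  "(\<lambda>n. mean_time n / (sqrt (8 * pi * X n / curvature) * exp ((U x1 - U x0) / X n))) \<longlonglongrightarrow> 1"
proof -
  have pos: "0 < sqrt (8 * pi / curvature)" using curvature_pos by simp
  have "(\<lambda>n. mean_time n * escape_prob n / sqrt (X n) / sqrt (8 * pi / curvature)) \<longlonglongrightarrow>
      sqrt (8 * pi / curvature) / sqrt (8 * pi / curvature)"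
    by (intro tendsto_divide mean_time_asymptotics tendsto_const) (use pos in linarith)
  moreover have "mean_time n * escape_prob n / sqrt (X n) / sqrt (8 * pi / curvature) =
      mean_time n / (sqrt (8 * pi * X n / curvature) * exp ((U x1 - U x0) / X n))" for n
  proof -
    have "sqrt (8 * pi * X n / curvature) = sqrt (8 * pi / curvature) * sqrt (X n)"
      by (simp add: real_sqrt_mult[symmetric])
    then show ?thesis by (simp add: escape_prob_def exp_minus divide_inverse mult_ac)
  qed
  ultimately show ?thesis using curvature_pos by simp
qed

definition rescaled_law :: "nat \<Rightarrow> real measure" where
  "rescaled_law n = distr (M n) borel (\<lambda>\<omega>. enn2real (\<tau> n \<omega>) / mean_time n)"

lemma time_measurable [measurable]: "\<tau> n \<in> borel_measurable (M n)"
  using escape_cycles.\<tau>_measurable[OF cycles] .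

lemma rescaled_law_distribution: "real_distribution (rescaled_law n)"
proof -
  have "prob_space (M n)"
    using cycles[of n] unfolding escape_cycles_def exponential_clocks_def iid_exponential_def by blast
  then show ?thesis
    unfolding rescaled_law_def by (rule prob_space.real_distribution_distr) measurable
qed

text \<open>
  With \<open>a\<close> and \<open>b - p\<close> for the transforms of the two excursions, \<open>a - 1\<close> and \<open>b - 1\<close> are both
  \<open>\<i> s p / 2 + o(p)\<close>, so \<open>1 - a (b - p)\<close> is \<open>p (1 - \<i> s) + o(p)\<close>; the factor \<open>p\<close> cancels
  against the one in the numerator.
\<close>

lemma char_rescaled_law_limit: "(\<lambda>n. char (rescaled_law n) s) \<longlonglongrightarrow> char std_exponential s"
proof -
  define \<theta> where "\<theta> n = s / mean_time n" for n
  define L where "L = sqrt (8 * pi / curvature)"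
  define c where "c = sqrt (2 / curvature) * (sqrt pi / 2)"
  have L: "L = 4 * c" "0 < c"
    using sqrt_8_pi[of curvature] curvature_pos by (simp_all add: L_def c_def)
  \<comment> \<open>The factor that makes \<open>2 * \<theta>\<close> times an excursion the product of \<open>q\<close>, the small scale \<open>escape_prob\<close>
    and the rescaled excursion.\<close>
  define q where "q n = 2 * (\<theta> n * sqrt (X n) / escape_prob n)" for n
  have "(\<lambda>n. 2 * (s / (mean_time n * escape_prob n / sqrt (X n)))) \<longlonglongrightarrow> 2 * (s / L)"
    unfolding L_def using curvature_pos by (intro tendsto_intros mean_time_asymptotics) auto
  then have q: "q \<longlonglongrightarrow> 2 * (s / L)"
    by (rule Lim_transform_eventually) (simp add: q_def \<theta>_def)
  have scaled: "2 * \<theta> n * f = q n * escape_prob n * (f / sqrt (X n))" for n f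
    using X_pos[of n] escape_prob_pos[of n] by (simp add: q_def)
  obtain w where w: "integrable std_exponential w"
    "\<And>n. AE v in std_exponential. \<bar>left_excursion (X n) v / sqrt (X n)\<bar> \<le> w v"
    "\<And>n. AE v in std_exponential. \<bar>right_excursion (X n) v / sqrt (X n)\<bar> \<le> w v"
    using excursion_dominated by metis
  define a where "a n = (\<integral>v. iexp (2 * \<theta> n * left_excursion (X n) v) \<partial>std_exponential)" for n
  define b where "b n = (\<integral>v. iexp (2 * \<theta> n * right_excursion (X n) v) \<partial>std_exponential)" for n
  have limit_value: "\<i> * complex_of_real (2 * (s / L)) *
      (\<integral>v. sqrt (2 / curvature) * sqrt v \<partial>std_exponential) = \<i> * s / 2"
    unfolding integral_limit_excursion c_def[symmetric] L(1) using L(2) by (simp add: field_simps)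
  have a: "(\<lambda>n. (a n - 1) / escape_prob n) \<longlonglongrightarrow> \<i> * s / 2"
    unfolding a_def scaled limit_value[symmetric]
    by (rule std_exponential.iexp_expectation_expansion[OF _ _ w(1,2) excursion_limits_AE(1) q escape_prob_lim escape_prob_pos])
      measurable
  have b: "(\<lambda>n. (b n - 1) / escape_prob n) \<longlonglongrightarrow> \<i> * s / 2"
    unfolding b_def scaled limit_value[symmetric]
    by (rule std_exponential.iexp_expectation_expansion[OF _ _ w(1,3) excursion_limits_AE(2) q escape_prob_lim escape_prob_pos])
      measurable
  have p_lim: "(\<lambda>n. complex_of_real (escape_prob n)) \<longlonglongrightarrow> 0"
    using tendsto_of_real[OF escape_prob_lim] by simp
  have one: "f \<longlonglongrightarrow> 1" if "(\<lambda>n. (f n - 1) / escape_prob n) \<longlonglongrightarrow> \<i> * s / 2" for f :: "nat \<Rightarrow> complex"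
  proof -
    have "(\<lambda>n. 1 + (f n - 1) / escape_prob n * escape_prob n) \<longlonglongrightarrow> 1 + \<i> * s / 2 * 0"
      by (intro tendsto_intros that p_lim)
    moreover have "1 + (f n - 1) / escape_prob n * escape_prob n = f n" for n
      using escape_prob_pos[of n] by simp
    ultimately show ?thesis by simp
  qed
  define den where "den n = (1 - a n * (b n - escape_prob n)) / escape_prob n" for n
  have den: "den \<longlonglongrightarrow> 1 - \<i> * s"
  proof -
    have "(\<lambda>n. 1 - (a n - 1) / escape_prob n * (b n - escape_prob n) - (b n - 1) / escape_prob n) \<longlonglongrightarrow>
        1 - \<i> * s / 2 * (1 - 0) - \<i> * s / 2"
      by (intro tendsto_intros a b one[OF b] p_lim)
    moreover have "1 - (a n - 1) / escape_prob n * (b n - escape_prob n) - (b n - 1) / escape_prob n = den n" for n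
      using escape_prob_pos[of n] by (simp add: den_def field_simps)
    ultimately show ?thesis by simp
  qed
  have "\<theta> \<longlonglongrightarrow> 0"
  proof -
    have "(\<lambda>n. q n / 2 * (escape_prob n / sqrt (X n))) \<longlonglongrightarrow> 2 * (s / L) / 2 * 0"
      by (intro tendsto_intros q escape_prob_negligible) simp
    moreover have "q n / 2 * (escape_prob n / sqrt (X n)) = \<theta> n" for n
      using X_pos[of n] escape_prob_pos[of n] by (simp add: q_def)
    ultimately show ?thesis by simp
  qed
  then have "(\<lambda>n. a n * iexp (\<theta> n * (x1 - x0)) / den n) \<longlonglongrightarrow> 1 * iexp (0 * (x1 - x0)) / (1 - \<i> * s)"
    by (intro tendsto_intros one[OF a] den) (auto simp: complex_eq_iff)
  moreover have "a n * iexp (\<theta> n * (x1 - x0)) / den n = char (rescaled_law n) s" for n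
  proof -
    have "char (rescaled_law n) s = (\<integral>\<omega>. iexp (\<theta> n * enn2real (\<tau> n \<omega>)) \<partial>M n)"
      unfolding char_def rescaled_law_def by (subst integral_distr) (auto simp: \<theta>_def)
    also have "\<dots> = a n * (escape_prob n * iexp (\<theta> n * (x1 - x0))) / (1 - a n * (b n - escape_prob n))"
      using escape_cycles.expectation_iexp_\<tau>[OF cycles, of n "\<theta> n"]
      by (simp add: escape_cycles.\<alpha>_def[OF cycles] escape_cycles.\<beta>_def[OF cycles] escape_cycles.p_def[OF cycles]
          a_def b_def escape_prob_def)
    also have "\<dots> = a n * iexp (\<theta> n * (x1 - x0)) / den n"
      using escape_prob_pos[of n] by (simp add: den_def)
    finally show ?thesis by simp
  qed
  ultimately show ?thesis by (simp add: std_exponential_char)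
qed

text \<open>
  Weak convergence gives the tail at \<open>t\<close> because the limit law has no atoms. It remains to undo the rescaling,
  which is legitimate where \<open>\<tau>\<close> is finite.
\<close>

lemma tail_limit:
  assumes t: "0 \<le> t"
  shows "(\<lambda>n. measure (M n) {\<omega> \<in> space (M n). ennreal t * (\<integral>\<^sup>+\<omega>. \<tau> n \<omega> \<partial>M n) \<le> \<tau> n \<omega>}) \<longlonglongrightarrow> exp (- t)"
proof -
  have "weak_conv_m rescaled_law std_exponential"
    by (rule levy_continuity[OF rescaled_law_distribution std_exponential.real_distribution_axioms char_rescaled_law_limit])
  moreover have "emeasure std_exponential (frontier {t..}) = 0"
  proof -
    have "emeasure std_exponential {t} = 0"
      using AE_std_exponential_neq[of t] by (subst (asm) AE_iff_measurable[of "{t}"]) auto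
    then show ?thesis by simp
  qed
  ultimately have "(\<lambda>n. measure (rescaled_law n) {t..}) \<longlonglongrightarrow> measure std_exponential {t..}"
    by (intro weak_conv_imp_continuity_set_conv rescaled_law_distribution std_exponential.real_distribution_axioms) auto
  moreover have "measure (rescaled_law n) {t..} =
      measure (M n) {\<omega> \<in> space (M n). ennreal t * (\<integral>\<^sup>+\<omega>. \<tau> n \<omega> \<partial>M n) \<le> \<tau> n \<omega>}" for n
  proof -
    have "measure (rescaled_law n) {t..} = measure (M n) {\<omega> \<in> space (M n). t \<le> enn2real (\<tau> n \<omega>) / mean_time n}"
      unfolding rescaled_law_def by (subst measure_distr) (auto intro!: arg_cong[where f = "measure (M n)"])
    also have "\<dots> = measure (M n) {\<omega> \<in> space (M n). ennreal t * (\<integral>\<^sup>+\<omega>. \<tau> n \<omega> \<partial>M n) \<le> \<tau> n \<omega>}"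
    proof (rule measure_eq_AE)
      have "AE \<omega> in M n. \<tau> n \<omega> < \<infinity>"
        using escape_cycles.AE_escapes[OF cycles, of n]
        by eventually_elim (auto dest!: escape_cycles.\<tau>_escapes[OF cycles])
      then show "AE \<omega> in M n. (\<omega> \<in> {\<omega> \<in> space (M n). t \<le> enn2real (\<tau> n \<omega>) / mean_time n}) =
          (\<omega> \<in> {\<omega> \<in> space (M n). ennreal t * (\<integral>\<^sup>+\<omega>. \<tau> n \<omega> \<partial>M n) \<le> \<tau> n \<omega>})"
      proof eventually_elim
        case (elim \<omega>)
        then obtain x where x: "0 \<le> x" "\<tau> n \<omega> = ennreal x"
          by (auto simp: less_top_ennreal)
        then show ?case
          using t mean_time_pos[of n]
          by (simp add: nn_integral_time ennreal_mult[symmetric] field_simps del: ennreal_mult)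
      qed
    qed measurable
    finally show ?thesis .
  qed
  ultimately show ?thesis
    using std_exponential_tail[OF t] by simp
qed

end

end

section \<open>The Eyring-Kramers formula and the exponential limit law\<close>

theorem theorem1:
  fixes U :: "real \<Rightarrow> real" and x0 x1 x2 :: real
    and M :: "real \<Rightarrow> 'a measure"
    and E :: "real \<Rightarrow> nat \<Rightarrow> 'a \<Rightarrow> real"
    and \<tau> :: "real \<Rightarrow> 'a \<Rightarrow> ennreal"
  assumes "double_well U x0 x1 x2"
    and "\<And>\<epsilon>. 0 < \<epsilon> \<Longrightarrow> iid_exponential (M \<epsilon>) (E \<epsilon>)"
    and "\<And>\<epsilon> \<omega>. \<tau> \<epsilon> \<omega> = hitting_time (\<lambda>t. fst (vjp U \<epsilon> x0 (-1) (\<lambda>i. E \<epsilon> i \<omega>) t)) x1"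
  shows "(\<forall>\<^sub>F \<epsilon> in at_right 0. (\<integral>\<^sup>+ \<omega>. \<tau> \<epsilon> \<omega> \<partial>M \<epsilon>) < \<infinity>)
    \<and> (\<lambda>\<epsilon>. enn2real (\<integral>\<^sup>+ \<omega>. \<tau> \<epsilon> \<omega> \<partial>M \<epsilon>)) \<sim>[at_right 0]
        (\<lambda>\<epsilon>. sqrt (8 * pi * \<epsilon> / deriv (deriv U) x0) * exp ((U x1 - U x0) / \<epsilon>))
    \<and> (\<forall>t\<ge>0. ((\<lambda>\<epsilon>. measure (M \<epsilon>)
           {\<omega> \<in> space (M \<epsilon>). \<tau> \<epsilon> \<omega> \<ge> ennreal t * (\<integral>\<^sup>+ \<omega>. \<tau> \<epsilon> \<omega> \<partial>M \<epsilon>)})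
         \<longlongrightarrow> exp (- t)) (at_right 0))"
proof -
  interpret double_well_potential U x0 x1 x2 by standard (rule assms(1))
  have cycles: "escape_cycles (M \<epsilon>) (E \<epsilon>) ((U x1 - U x0) / \<epsilon>) (x1 - x0)
      (left_excursion \<epsilon>) (right_excursion \<epsilon>) (\<tau> \<epsilon>)" if "0 < \<epsilon>" for \<epsilon>
    using escape_cycles_well[OF that assms(2)[OF that]] unfolding assms(3)[symmetric] .
  \<comment> \<open>Limits at \<open>0\<close> from the right are tested on sequences of temperatures, for which dominated
    convergence is available.\<close>
  have seq: "0 < S n" if "\<forall>n. S n \<in> {0<..} - {0}" for S :: "nat \<Rightarrow> real" and n
    using that by auto
  have "(\<integral>\<^sup>+ \<omega>. \<tau> \<epsilon> \<omega> \<partial>M \<epsilon>) < \<infinity>" if "0 < \<epsilon>" for \<epsilon>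
    using escape_cycles.expectation_\<tau>[OF cycles[OF that]] by simp
  then have "\<forall>\<^sub>F \<epsilon> in at_right 0. (\<integral>\<^sup>+ \<omega>. \<tau> \<epsilon> \<omega> \<partial>M \<epsilon>) < \<infinity>"
    using eventually_at_right_less[of 0] by (auto elim: eventually_mono)
  moreover have "(\<lambda>\<epsilon>. enn2real (\<integral>\<^sup>+ \<omega>. \<tau> \<epsilon> \<omega> \<partial>M \<epsilon>)) \<sim>[at_right 0]
        (\<lambda>\<epsilon>. sqrt (8 * pi * \<epsilon> / deriv (deriv U) x0) * exp ((U x1 - U x0) / \<epsilon>))"
  proof (rule asymp_equivI', unfold tendsto_at_iff_sequentially, intro allI impI)
    fix S assume S: "\<forall>n. S n \<in> {0<..} - {0::real}" "S \<longlonglongrightarrow> 0"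
    note pos = seq[OF S(1)]
    show "((\<lambda>\<epsilon>. enn2real (\<integral>\<^sup>+ \<omega>. \<tau> \<epsilon> \<omega> \<partial>M \<epsilon>) /
        (sqrt (8 * pi * \<epsilon> / deriv (deriv U) x0) * exp ((U x1 - U x0) / \<epsilon>))) \<circ> S) \<longlonglongrightarrow> 1"
      using mean_time_equivalent[OF pos S(2) cycles[OF pos]]
      unfolding mean_time_def[OF pos S(2) cycles[OF pos]] by (simp add: o_def)
  qed
  moreover have "((\<lambda>\<epsilon>. measure (M \<epsilon>)
           {\<omega> \<in> space (M \<epsilon>). \<tau> \<epsilon> \<omega> \<ge> ennreal t * (\<integral>\<^sup>+ \<omega>. \<tau> \<epsilon> \<omega> \<partial>M \<epsilon>)})
         \<longlongrightarrow> exp (- t)) (at_right 0)" if t: "0 \<le> t" for t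
  proof (unfold tendsto_at_iff_sequentially, intro allI impI)
    fix S assume S: "\<forall>n. S n \<in> {0<..} - {0::real}" "S \<longlonglongrightarrow> 0"
    note pos = seq[OF S(1)]
    show "((\<lambda>\<epsilon>. measure (M \<epsilon>) {\<omega> \<in> space (M \<epsilon>). \<tau> \<epsilon> \<omega> \<ge> ennreal t * (\<integral>\<^sup>+ \<omega>. \<tau> \<epsilon> \<omega> \<partial>M \<epsilon>)}) \<circ> S)
        \<longlonglongrightarrow> exp (- t)"
      using tail_limit[OF pos S(2) cycles[OF pos] t] by (simp add: o_def)
  qed
  ultimately show ?thesis by blast
qed

end
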